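(* Assume Assumption 1 holds with $M$ invertible and $V=M^{-1}$. Fix any prediction function $\mathcal C$, $\gamma\in(0,1)$, and let $\hat C^{\mathrm{cc}}(X_{n+1})$ be the output of Algorithm 3 computed with the true $V$. Then for every $k\in[K]$, $$\mathbb P\Big[\ \mathbb P\big[Y_{n+1}\in\hat C^{\mathrm{cc}}(X_{n+1})\mid Y_{n+1}=k,\mathcal D\big]\ge1-\alpha\ \Big]\ge1-\gamma.$$
   Context: Let $K\ge 2$, $d\ge 1$, $n\ge 2$ be integers and $[m]=\{1,\dots,m\}$. Let $(X_i,Y_i,\tilde Y_i)$, $i\in[n+1]$, be i.i.d. copies of a random triple $(X,Y,\tilde Y)$ with $X\in\mathbb R^d$, true (unobserved) label $Y\in[K]$ and observed, possibly contaminated, label $\tilde Y\in[K]$. The observed data are $\mathcal D=\{(X_i,\tilde Y_i)\}_{i\in[n]}$; $X_{n+1}$ is a test feature vector with unknown label $Y_{n+1}$. The index set $[n]$ is split, independently of all data, into disjoint nonempty sets $\mathcal D^{\mathrm{train}}$ and $\mathcal D^{\mathrm{cal}}$, and a classifier $\hat\pi$ is fitted using only the observations indexed by $\mathcal D^{\mathrm{train}}$. A prediction function is a map $\mathcal C$ (which may depend on $\hat\pi$) assigning to each $x\in\mathbb R^d$ and $\tau=(\tau_1,\dots,\tau_K)\in[0,1]^K$ a set $\mathcal C(x,\tau)\subseteq[K]$ such that: $\mathcal C(x,\tau)$ is nondecreasing (for inclusion) in each coordinate of $\tau$; whether $k\in\mathcal C(x,\tau)$ depends on $\tau$ only through $\tau_k$;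 and $k\in\mathcal C(x,\tau)$ whenever $\tau_k=1$. The associated conformity score is $\hat s(x,k)=\inf\{\tau_k\in[0,1]: k\in\mathcal C(x,\tau)\}$, and it is understood that $k\in\mathcal C(x,\tau)$ if and only if $\hat s(x,k)\le\tau_k$. Let $\alpha\in(0,1)$. For $k\in[K]$ let $\mathcal D^{\mathrm{cal}}_k=\{i\in\mathcal D^{\mathrm{cal}}:\tilde Y_i=k\}$ and $n_k=|\mathcal D^{\mathrm{cal}}_k|$. All probabilities and expectations are conditional on the split and on $(n_1,\dots,n_K)$, which are treated as fixed with $n_k\ge1$ for all $k$; $n_*=\min_k n_k$. Assumption 1 (linear contamination): $\tilde Y$ is conditionally independent of $X$ given $Y$; all classes have positive probability under both $Y$ and $\tilde Y$. Let $M\in[0,1]^{K\times K}$, $M_{kl}=\mathbb P[Y=l\mid\tilde Y=k]$ (rows of $M$ sum to $1$). Algorithm 3 (calibration-conditional adaptive method, given $V$ and $\gamma$): for $k,l\in[K]$ let $\hat F^k_l(t)=\frac1{n_l}\sum_{i\in\mathcal D^{\mathrm{cal}}_l}\mathbf 1\{\hat s(X_i,k)\le t\}$, $\hat\Delta_k(t)=(V_{kk}-1)\hat F^k_k(t)+\sum_{l\ne k}V_{kl}\hat F^k_l(t)$, and let $S^k_{(1)}\le\dots\le S^k_{(n_k)}$ be the order statistics of $\{\hat s(X_i,k):i\in\mathcal D^{\mathrm{cal}}_k\}$. Let $r_k=\sum_{l\ne k}|V_{kl}|/\sum_{l=1}^K|V_{kl}|$, $\gamma_1=\gamma(1-r_k/2)$,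 $\gamma_2=\gamma r_k/2$, and $$\delta^{\mathrm{cc}}(n_k,n_*,\gamma)=\sqrt{\frac{\log(1/\gamma_1)}{2n_k}}+2\sum_{l\ne k}|V_{kl}|\sqrt{\frac{\log(2K)+\log(1/\gamma_2)}{2n_*}},$$ the second term being $0$ when $\sum_{l\ne k}|V_{kl}|=0$. Let $\hat{\mathcal I}_k=\{i\in[n_k]: i/n_k\ge1-\alpha-\hat\Delta_k(S^k_{(i)})+\delta^{\mathrm{cc}}(n_k,n_*,\gamma)\}$, $\hat\tau_k=S^k_{(\min\hat{\mathcal I}_k)}$ if $\hat{\mathcal I}_k\ne\emptyset$ and $\hat\tau_k=1$ otherwise; output $\hat C^{\mathrm{cc}}(X_{n+1})=\mathcal C(X_{n+1},(\hat\tau_1,\dots,\hat\tau_K))$. *)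

theory Defs
  imports "HOL-Probability.Probability"
begin

text \<open>Labels are the natural numbers 1..K. A threshold vector tau in [0,1]^K is a
  function nat => real whose values on 1..K lie in [0,1].\<close>

definition thr_vec :: "nat \<Rightarrow> (nat \<Rightarrow> real) \<Rightarrow> bool" where
  "thr_vec K \<tau> \<longleftrightarrow> (\<forall>j\<in>{1..K}. \<tau> j \<in> {0..1})"

definition is_prediction_function :: "nat \<Rightarrow> ('x \<Rightarrow> (nat \<Rightarrow> real) \<Rightarrow> nat set) \<Rightarrow> bool" where
  "is_prediction_function K C \<longleftrightarrow>
     (\<forall>x \<tau>. thr_vec K \<tau> \<longrightarrow> C x \<tau> \<subseteq> {1..K}) \<and>
     \<comment> \<open>nondecreasing in each coordinate of tau\<close>
     (\<forall>x \<tau> \<tau>'. thr_vec K \<tau> \<and> thr_vec K \<tau>' \<and> (\<forall>j\<in>{1..K}. \<tau> j \<le> \<tau>' j) \<longrightarrow> C x \<tau> \<subseteq> C x \<tau>') \<and>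
     \<comment> \<open>membership of k depends on tau only through tau k\<close>
     (\<forall>x \<tau> \<tau>' k. thr_vec K \<tau> \<and> thr_vec K \<tau>' \<and> k \<in> {1..K} \<and> \<tau> k = \<tau>' k \<longrightarrow>
        (k \<in> C x \<tau> \<longleftrightarrow> k \<in> C x \<tau>')) \<and>
     \<comment> \<open>k is included whenever tau k = 1\<close>
     (\<forall>x \<tau> k. thr_vec K \<tau> \<and> k \<in> {1..K} \<and> \<tau> k = 1 \<longrightarrow> k \<in> C x \<tau>)"

definition cscore :: "nat \<Rightarrow> ('x \<Rightarrow> (nat \<Rightarrow> real) \<Rightarrow> nat set) \<Rightarrow> 'x \<Rightarrow> nat \<Rightarrow> real" where
  "cscore K C x k = Inf {\<tau> k | \<tau>. thr_vec K \<tau> \<and> k \<in> C x \<tau>}"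

definition score_convention :: "nat \<Rightarrow> ('x \<Rightarrow> (nat \<Rightarrow> real) \<Rightarrow> nat set) \<Rightarrow> bool" where
  "score_convention K C \<longleftrightarrow>
     (\<forall>x \<tau> k. thr_vec K \<tau> \<and> k \<in> {1..K} \<longrightarrow> (k \<in> C x \<tau> \<longleftrightarrow> cscore K C x k \<le> \<tau> k))"

text \<open>Calibration data: a data function D : index => (feature, observed label),
  a calibration index set Dcal, a score s : feature => label => real.\<close>

definition cal_idx :: "nat set \<Rightarrow> (nat \<Rightarrow> 'x \<times> nat) \<Rightarrow> nat \<Rightarrow> nat set" where
  "cal_idx Dcal D k = {i \<in> Dcal. snd (D i) = k}"

definition ncount :: "nat set \<Rightarrow> (nat \<Rightarrow> 'x \<times> nat) \<Rightarrow> nat \<Rightarrow> nat" where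
  "ncount Dcal D k = card (cal_idx Dcal D k)"

definition nmin :: "nat \<Rightarrow> nat set \<Rightarrow> (nat \<Rightarrow> 'x \<times> nat) \<Rightarrow> nat" where
  "nmin K Dcal D = Min (ncount Dcal D ` {1..K})"

definition Fhat :: "('x \<Rightarrow> nat \<Rightarrow> real) \<Rightarrow> nat set \<Rightarrow> (nat \<Rightarrow> 'x \<times> nat) \<Rightarrow> nat \<Rightarrow> nat \<Rightarrow> real \<Rightarrow> real" where
  "Fhat s Dcal D k l t =
     real (card {i \<in> cal_idx Dcal D l. s (fst (D i)) k \<le> t}) / real (ncount Dcal D l)"

definition Deltahat :: "nat \<Rightarrow> (nat \<Rightarrow> nat \<Rightarrow> real) \<Rightarrow> ('x \<Rightarrow> nat \<Rightarrow> real) \<Rightarrow> nat set \<Rightarrow>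
    (nat \<Rightarrow> 'x \<times> nat) \<Rightarrow> nat \<Rightarrow> real \<Rightarrow> real" where
  "Deltahat K V s Dcal D k t =
     (V k k - 1) * Fhat s Dcal D k k t + (\<Sum>l\<in>{1..K} - {k}. V k l * Fhat s Dcal D k l t)"

text \<open>Order statistics S^k_(1) <= ... <= S^k_(n_k) (1-based index i).\<close>
definition ostat :: "('x \<Rightarrow> nat \<Rightarrow> real) \<Rightarrow> nat set \<Rightarrow> (nat \<Rightarrow> 'x \<times> nat) \<Rightarrow> nat \<Rightarrow> nat \<Rightarrow> real" where
  "ostat s Dcal D k i =
     sort (map (\<lambda>j. s (fst (D j)) k) (sorted_list_of_set (cal_idx Dcal D k))) ! (i - 1)"

definition rk :: "nat \<Rightarrow> (nat \<Rightarrow> nat \<Rightarrow> real) \<Rightarrow> nat \<Rightarrow> real" where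
  "rk K V k = (\<Sum>l\<in>{1..K} - {k}. \<bar>V k l\<bar>) / (\<Sum>l\<in>{1..K}. \<bar>V k l\<bar>)"

definition delta_cc :: "nat \<Rightarrow> (nat \<Rightarrow> nat \<Rightarrow> real) \<Rightarrow> nat \<Rightarrow> nat \<Rightarrow> nat \<Rightarrow> real \<Rightarrow> real" where
  "delta_cc K V k nk nst \<gamma> =
     (let r = rk K V k; \<gamma>\<^sub>1 = \<gamma> * (1 - r / 2); \<gamma>\<^sub>2 = \<gamma> * r / 2;
          A = (\<Sum>l\<in>{1..K} - {k}. \<bar>V k l\<bar>) in
      sqrt (ln (1 / \<gamma>\<^sub>1) / (2 * real nk)) +
      (if A = 0 then 0
       else 2 * A * sqrt ((ln (2 * real K) + ln (1 / \<gamma>\<^sub>2)) / (2 * real nst))))"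

definition Ihat :: "nat \<Rightarrow> (nat \<Rightarrow> nat \<Rightarrow> real) \<Rightarrow> real \<Rightarrow> real \<Rightarrow> ('x \<Rightarrow> nat \<Rightarrow> real) \<Rightarrow> nat set \<Rightarrow>
    (nat \<Rightarrow> 'x \<times> nat) \<Rightarrow> nat \<Rightarrow> nat set" where
  "Ihat K V \<alpha> \<gamma> s Dcal D k =
     {i \<in> {1..ncount Dcal D k}.
        real i / real (ncount Dcal D k) \<ge>
          1 - \<alpha> - Deltahat K V s Dcal D k (ostat s Dcal D k i)
            + delta_cc K V k (ncount Dcal D k) (nmin K Dcal D) \<gamma>}"

definition tauhat_cc :: "nat \<Rightarrow> (nat \<Rightarrow> nat \<Rightarrow> real) \<Rightarrow> real \<Rightarrow> real \<Rightarrow> ('x \<Rightarrow> nat \<Rightarrow> real) \<Rightarrow> nat set \<Rightarrow>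
    (nat \<Rightarrow> 'x \<times> nat) \<Rightarrow> nat \<Rightarrow> real" where
  "tauhat_cc K V \<alpha> \<gamma> s Dcal D k =
     (if Ihat K V \<alpha> \<gamma> s Dcal D k = {} then 1
      else ostat s Dcal D k (Min (Ihat K V \<alpha> \<gamma> s Dcal D k)))"

text \<open>P is a measure on triples (x, y, ytilde).\<close>

definition lab_pos :: "nat \<Rightarrow> ('x \<times> nat \<times> nat) measure \<Rightarrow> bool" where
  "lab_pos K P \<longleftrightarrow> (\<forall>k\<in>{1..K}.
     measure P {z \<in> space P. fst (snd z) = k} > 0 \<and> measure P {z \<in> space P. snd (snd z) = k} > 0)"

definition cond_indep_X_Yt_given_Y :: "nat \<Rightarrow> 'x measure \<Rightarrow> ('x \<times> nat \<times> nat) measure \<Rightarrow> bool" where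
  "cond_indep_X_Yt_given_Y K MX P \<longleftrightarrow> (\<forall>A\<in>sets MX. \<forall>l\<in>{1..K}. \<forall>k\<in>{1..K}.
     measure P {z \<in> space P. fst z \<in> A \<and> fst (snd z) = l \<and> snd (snd z) = k}
       * measure P {z \<in> space P. fst (snd z) = l}
     = measure P {z \<in> space P. fst z \<in> A \<and> fst (snd z) = l}
       * measure P {z \<in> space P. fst (snd z) = l \<and> snd (snd z) = k})"

definition Mmat :: "('x \<times> nat \<times> nat) measure \<Rightarrow> nat \<Rightarrow> nat \<Rightarrow> real" where
  "Mmat P k l = measure P {z \<in> space P. fst (snd z) = l \<and> snd (snd z) = k}
                / measure P {z \<in> space P. snd (snd z) = k}"

definition is_inverse_mat :: "nat \<Rightarrow> (nat \<Rightarrow> nat \<Rightarrow> real) \<Rightarrow> (nat \<Rightarrow> nat \<Rightarrow> real) \<Rightarrow> bool" where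
  "is_inverse_mat K M V \<longleftrightarrow> (\<forall>k\<in>{1..K}. \<forall>l\<in>{1..K}.
     (\<Sum>j\<in>{1..K}. M k j * V j l) = (if k = l then 1 else 0) \<and>
     (\<Sum>j\<in>{1..K}. V k j * M j l) = (if k = l then 1 else 0))"

definition triple_space :: "('x::topological_space \<times> nat \<times> nat) measure" where
  "triple_space = borel \<Otimes>\<^sub>M (count_space UNIV \<Otimes>\<^sub>M count_space UNIV)"

definition train_space :: "nat set \<Rightarrow> (nat \<Rightarrow> 'x::topological_space \<times> nat) measure" where
  "train_space Dtr = (\<Pi>\<^sub>M i\<in>Dtr. borel \<Otimes>\<^sub>M count_space UNIV)"

definition triple :: "(nat \<Rightarrow> 'w \<Rightarrow> 'x) \<Rightarrow> (nat \<Rightarrow> 'w \<Rightarrow> nat) \<Rightarrow> (nat \<Rightarrow> 'w \<Rightarrow> nat) \<Rightarrow>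
    nat \<Rightarrow> 'w \<Rightarrow> 'x \<times> nat \<times> nat" where
  "triple Xs Ys Yt i \<omega> = (Xs i \<omega>, Ys i \<omega>, Yt i \<omega>)"

definition obsdata :: "(nat \<Rightarrow> 'w \<Rightarrow> 'x) \<Rightarrow> (nat \<Rightarrow> 'w \<Rightarrow> nat) \<Rightarrow> 'w \<Rightarrow> nat \<Rightarrow> 'x \<times> nat" where
  "obsdata Xs Yt \<omega> = (\<lambda>i. (Xs i \<omega>, Yt i \<omega>))"

definition train_data :: "nat set \<Rightarrow> (nat \<Rightarrow> 'w \<Rightarrow> 'x) \<Rightarrow> (nat \<Rightarrow> 'w \<Rightarrow> nat) \<Rightarrow> 'w \<Rightarrow> nat \<Rightarrow> 'x \<times> nat" where
  "train_data Dtr Xs Yt \<omega> = (\<lambda>i\<in>Dtr. (Xs i \<omega>, Yt i \<omega>))"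

text \<open>Chat^cc(x) = C(x, (tauhat_1..tauhat_K)), where the prediction function C = Cfam t
  is built from the training data t (via the fitted classifier).\<close>
definition Chat_cc :: "nat \<Rightarrow> (nat \<Rightarrow> nat \<Rightarrow> real) \<Rightarrow> real \<Rightarrow> real \<Rightarrow>
    ((nat \<Rightarrow> 'x \<times> nat) \<Rightarrow> 'x \<Rightarrow> (nat \<Rightarrow> real) \<Rightarrow> nat set) \<Rightarrow> nat set \<Rightarrow> nat set \<Rightarrow>
    (nat \<Rightarrow> 'w \<Rightarrow> 'x) \<Rightarrow> (nat \<Rightarrow> 'w \<Rightarrow> nat) \<Rightarrow> 'w \<Rightarrow> 'x \<Rightarrow> nat set" where
  "Chat_cc K V \<alpha> \<gamma> Cfam Dtr Dcal Xs Yt \<omega> x =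
     (let C = Cfam (train_data Dtr Xs Yt \<omega>)
      in C x (tauhat_cc K V \<alpha> \<gamma> (cscore K C) Dcal (obsdata Xs Yt \<omega>)))"

end

theory Submission
  imports Defs
begin

text \<open>
  The rows of \<open>V\<close> sum to one, and linear contamination gives \<open>F k = (\<Sum>l. V k l * Ft l)\<close>, where \<open>F k\<close> is
  the distribution function of the score given \<open>Y = k\<close> and \<open>Ft l\<close> the one given the observed label \<open>l\<close>.
  Hence \<open>(\<Sum>l. V k l * (Fhat l - Ft l)) = (Fhat k - Ft k) + (\<Sum>l\<noteq>k. V k l * ((Fhat l - Ft l) - (Fhat k - Ft k)))\<close>, and
  \<open>delta_cc\<close> bounds this uniformly in the threshold on an event of conditional probability at least \<open>1 - \<gamma>\<close>: the
  first summand by the one-sided Dvoretzky-Kiefer-Wolfowitz inequality at level \<open>\<gamma>1\<close>, the second one by the two-sided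
  inequality for all classes at level \<open>\<gamma>2\<close>. On that event the choice of the threshold forces coverage \<open>1 - \<alpha>\<close>.
  
  Since \<open>\<gamma>1\<close> may exceed \<open>1/2\<close>, the one-sided inequality \<open>exp (- 2 n e\<^sup>2)\<close> is needed for every \<open>e \<ge> 0\<close>,
  beyond the range of Massart's theorem. It is proved by a change of measure: scanning the thresholds downwards, compare the
  sample at the first crossing of \<open>F + e\<close> with a sample of which a fraction \<open>1 - exp (- 2 e - (2/3) e\<^sup>2)\<close> is moved to
  the bottom. The likelihood ratio at the crossing is at least \<open>exp (2 n e\<^sup>2)\<close>, wherever the crossing occurs.
\<close>

text \<open>The theorem conditions on the class counts only, which leaves the index set of each
  class random. The proof conditions more finely, on a complete assignment \<open>y\<close> of the
  calibration labels (event \<open>W y\<close>): then the index sets are fixed, the calibration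
  triples stay independent, and those of class \<open>l\<close> share the law \<open>P\<close> given
  observed label \<open>l\<close>. Every bound is kept in the multiplied form "probability within
  \<open>W y\<close> at most level times \<open>prob (W y)\<close>", so that summing over all
  assignments with the prescribed counts needs no division. The score is itself random through the
  training data. Independence of the two blocks lets Fubini freeze it, after which its level sets
  form a fixed chain. Control uniform in the threshold is unavoidable, since the threshold is chosen
  from the same calibration sample. Centering all deviations at class \<open>k\<close> gives its
  deviation the coefficient 1 instead of \<open>V k k\<close>; only this one needs the sharp
  one-sided bound with its own sample size.\<close>

section \<open>The Dvoretzky-Kiefer-Wolfowitz inequality\<close>

text \<open>In \<open>y\<close> the expression reads \<open>a * y\<^sup>2 - b * y + 3 * e\<close>
  with \<open>a > 0\<close>, so a nonpositive discriminant suffices. With \<open>E = e * x\<close>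
  the discriminant is \<open>e\<^sup>2\<close> times a quadratic in \<open>x\<close>, whose roots at
  \<open>e = 0\<close> are 2 and 26. Since \<open>x\<close> tends to 2 as \<open>e\<close> tends to
  0, the lower bound on \<open>x\<close> has to be sharp there: the smaller root grows like 2 +
  (2/3) e, which the linear bound on \<open>exp\<close> only matches to first order, and the
  quadratic Taylor term supplies the slack. The upper bound may be crude.\<close>

lemma dkw_quadratic_nonneg:
  fixes e y :: real
  assumes e: "0 < e" "e \<le> 1"
  defines "E \<equiv> exp (2 * e + 2 / 3 * e\<^sup>2) - 1"
  shows "0 \<le> 2 * e * (1 - y) * (1 - (2 + 2 / 3 * e) * y)
    + (y * E - e) * ((4 + 4 * e + 4 / 3 * e\<^sup>2) * y - 1)"
proof -
  define x where "x = E / e"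
  have Ex: "E = e * x" using e by (simp add: x_def)
  have "1 + (2 * e + 2 / 3 * e\<^sup>2) + (2 * e + 2 / 3 * e\<^sup>2)\<^sup>2 / 2 \<le> exp (2 * e + 2 / 3 * e\<^sup>2)"
    using e by (intro exp_lower_Taylor_quadratic) auto
  moreover have "(2 * e)\<^sup>2 \<le> (2 * e + 2 / 3 * e\<^sup>2)\<^sup>2"
    using e by (intro power_mono) auto
  ultimately have "2 * e + 2 / 3 * e\<^sup>2 + 2 * e\<^sup>2 \<le> E"
    unfolding E_def by (simp add: power_mult_distrib)
  also have "2 * e + 2 / 3 * e\<^sup>2 + 2 * e\<^sup>2 = e * (2 + 8 / 3 * e)"
    by (simp add: power2_eq_square algebra_simps)
  finally have lo: "2 + 8 / 3 * e \<le> x" using e by (simp add: Ex)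
  \<comment> \<open>8/3 is the exponent \<open>2 * e + 2 / 3 * e\<^sup>2\<close> at
    \<open>e = 1\<close>. The chord of the convex function \<open>exp\<close> over [0, 8/3] then
    gives \<open>exp (2 * e + 2 / 3 * e\<^sup>2) \<le> 1 + 20 * e\<close>, that is
    \<open>x \<le> 20\<close>.\<close>
  have e83: "exp (8 / 3 :: real) \<le> 21"
  proof -
    have "exp (8/3::real) = exp (1/3) ^ 8" by (simp flip: exp_of_nat_mult)
    also have "exp (1/3::real) \<le> 1 + 1/3 + (1/3)\<^sup>2" by (rule exp_bound) auto
    hence "exp (1/3::real) ^ 8 \<le> (1 + 1/3 + (1/3)\<^sup>2) ^ 8" by (intro power_mono) auto
    also have "\<dots> \<le> 21" by (simp add: power2_eq_square power_divide)
    finally show ?thesis .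
  qed
  have "e\<^sup>2 \<le> e" using e by (simp add: power2_eq_square mult_left_le)
  hence "exp (2 * e + 2 / 3 * e\<^sup>2) \<le> exp ((1 - e) * 0 + e * (8 / 3))" by simp
  also have "\<dots> \<le> (1 - e) * exp 0 + e * exp (8 / 3)"
    using convex_onD[OF exp_convex, of e 0 "8/3"] e by simp
  also have "\<dots> \<le> (1 - e) * 1 + e * 21" using e e83 by (intro add_mono mult_left_mono) auto
  finally have "e * x \<le> e * 20" unfolding Ex[symmetric] E_def by simp
  hence hi: "x \<le> 20" using e by simp
  have xq: "(x - (2 + 8/3*e)) * (x - 20) \<le> 0" using lo hi by (intro mult_nonneg_nonpos) auto
  have xl: "(x - (2 + 8/3*e)) * (6 + 104/3 * e + 40/3 * e\<^sup>2) \<ge> 0" using lo e by (intro mult_nonneg_nonneg) auto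
  have "16/9 * e ^ 4 \<le> 64/3 * e ^ 3" using e power_decreasing[of 3 4 e] zero_le_power[of e 3] by linarith
  hence el: "48 * e + 64 * e\<^sup>2 + 64/3 * e ^ 3 - 16/9 * e ^ 4 \<ge> 0" using e zero_le_power[of e 2] by linarith
  have "x\<^sup>2 - x * (28 + 112/3 * e + 40/3 * e\<^sup>2) + (10 + 16/3*e + 4/3*e\<^sup>2)\<^sup>2 - 48 - 16 * e
    = (x - (2 + 8/3*e)) * (x - 20) - (x - (2 + 8/3*e)) * (6 + 104/3 * e + 40/3 * e\<^sup>2)
      - (48 * e + 64 * e\<^sup>2 + 64/3 * e ^ 3 - 16/9 * e ^ 4)"
    by algebra
  with xq xl el have disc: "x\<^sup>2 - x * (28 + 112/3 * e + 40/3 * e\<^sup>2) + (10 + 16/3*e + 4/3*e\<^sup>2)\<^sup>2 - 48 - 16 * e \<le> 0"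
    by linarith
  define a where "a = 4 * e + 4/3 * e\<^sup>2 + E * (4 + 4 * e + 4/3 * e\<^sup>2)"
  define b where "b = E + 10 * e + 16/3 * e\<^sup>2 + 4/3 * e ^ 3"
  have a0: "a > 0" unfolding a_def Ex using e lo by (intro add_pos_nonneg) auto
  have "b\<^sup>2 - 12 * a * e = e\<^sup>2 * (x\<^sup>2 - x * (28 + 112/3 * e + 40/3 * e\<^sup>2) + (10 + 16/3*e + 4/3*e\<^sup>2)\<^sup>2 - 48 - 16 * e)"
    unfolding a_def b_def Ex by algebra
  also have "\<dots> \<le> 0" using disc by (intro mult_nonneg_nonpos) auto
  finally have "0 \<le> (2 * a * y - b)\<^sup>2 + (12 * a * e - b\<^sup>2)" by simp
  also have "\<dots> = (4 * a) * (2 * e * (1 - y) * (1 - (2 + 2 / 3 * e) * y)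
    + (y * E - e) * ((4 + 4 * e + 4 / 3 * e\<^sup>2) * y - 1))"
    unfolding a_def b_def by algebra
  finally show ?thesis using a0 by (simp add: zero_le_mult_iff)
qed

text \<open>
  Consider the law that moves mass \<open>1 - exp (- \<theta>)\<close>, \<open>\<theta> = 2 e + (2/3) e\<^sup>2\<close>, to the bottom of the line. At a point
  of probability \<open>T\<close> where the empirical frequency equals \<open>T + e\<close>, its log-likelihood ratio per observation is the
  right-hand side minus \<open>\<theta>\<close>. The coefficient \<open>2/3\<close> is the only one for which the third-order term in \<open>e\<close> of
  the difference is nonnegative for every \<open>T\<close>. The second derivative of the difference in \<open>e\<close> is a positive multiple
  of the quadratic in \<open>dkw_quadratic_nonneg\<close>.
\<close>

lemma dkw_exponent:
  fixes T e :: real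
  assumes T: "0 < T" and e: "0 \<le> e" "e \<le> 1"
  shows "2 * e + 2 / 3 * e\<^sup>2 + 2 * e\<^sup>2 \<le> (T + e) * ln (1 + (exp (2 * e + 2 / 3 * e\<^sup>2) - 1) / T)"
proof -
  define E where "E = (\<lambda>e::real. exp (2 * e + 2 / 3 * e\<^sup>2) - 1)"
  define t where "t = (\<lambda>e::real. 2 + 4 / 3 * e)"
  define H where "H = (\<lambda>e. (T + e) * (ln (T + E e) - ln T) - (2 * e + 2 / 3 * e\<^sup>2) - 2 * e\<^sup>2)"
  define H1 where "H1 = (\<lambda>e. ln (T + E e) - ln T + (T + e) * (t e * (1 + E e)) / (T + E e) - t e - 4 * e)"
  define H2 where "H2 = (\<lambda>e. 2 * (t e * (1 + E e)) / (T + E e) + (T + e) * ((4 / 3 + (t e)\<^sup>2) * (1 + E e)) / (T + E e)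
      - (T + e) * (t e * (1 + E e))\<^sup>2 / (T + E e)\<^sup>2 - 16 / 3)"
  have TE: "T + E x > 0" if "x \<ge> 0" for x using T that by (simp add: E_def add_pos_nonneg)
  have dE: "(E has_real_derivative t x * (1 + E x)) (at x)" for x
    unfolding E_def t_def by (auto intro!: derivative_eq_intros simp: power2_eq_square)
  have dt: "(t has_real_derivative 4 / 3) (at x)" for x
    unfolding t_def by (auto intro!: derivative_eq_intros)
  have dH: "(H has_real_derivative H1 x) (at x)" if "x \<ge> 0" for x
    unfolding H_def H1_def using TE[OF that] dE
    by (auto intro!: derivative_eq_intros simp: t_def)
  have dH1: "(H1 has_real_derivative H2 x) (at x)" if "x \<ge> 0" for x
  proof -
    have w: "T + E x \<noteq> 0" using TE[OF that] by simp
    have "((\<lambda>e. (T + e) * (t e * (1 + E e)) / (T + E e)) has_real_derivative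
        ((t x * (1 + E x) + (4 / 3 * (1 + E x) + t x * (1 + E x) * t x) * (T + x)) * (T + E x)
          - (T + x) * (t x * (1 + E x)) * (t x * (1 + E x))) / ((T + E x) * (T + E x))) (at x)"
      using w by (auto intro!: derivative_eq_intros dE dt)
    moreover have "((\<lambda>e. ln (T + E e) - ln T) has_real_derivative t x * (1 + E x) / (T + E x)) (at x)"
      using TE[OF that] by (auto intro!: derivative_eq_intros dE)
    ultimately have "(H1 has_real_derivative t x * (1 + E x) / (T + E x) +
        ((t x * (1 + E x) + (4 / 3 * (1 + E x) + t x * (1 + E x) * t x) * (T + x)) * (T + E x)
          - (T + x) * (t x * (1 + E x)) * (t x * (1 + E x))) / ((T + E x) * (T + E x)) - 4 / 3 - 4) (at x)"
      unfolding H1_def by (intro DERIV_add DERIV_diff dt DERIV_cmult_Id)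
    also have "t x * (1 + E x) / (T + E x) +
        ((t x * (1 + E x) + (4 / 3 * (1 + E x) + t x * (1 + E x) * t x) * (T + x)) * (T + E x)
          - (T + x) * (t x * (1 + E x)) * (t x * (1 + E x))) / ((T + E x) * (T + E x)) - 4 / 3 - 4 = H2 x"
      unfolding H2_def using w by (simp add: divide_simps) algebra
    finally show ?thesis .
  qed
  have H2: "H2 x \<ge> 0" if x: "0 < x" "x < 1" for x
  proof -
    \<comment> \<open>With this \<open>y\<close> one has
      \<open>T + E x = (1 + E x) * (1 - y)\<close>, so a factor \<open>(1 + E x)\<^sup>2\<close>
      splits off and \<open>T\<close> disappears from what remains.\<close>
    define y where "y = (1 - T) / (1 + E x)"
    have E0: "1 + E x > 0" by (simp add: E_def)
    have Ty: "T = 1 - y * (1 + E x)" using E0 by (simp add: y_def)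
    have TE0: "T + E x > 0" using TE x by simp
    have "(T + E x)\<^sup>2 * H2 x = (2 * (t x * (1 + E x)) + (T + x) * ((4 / 3 + (t x)\<^sup>2) * (1 + E x))) * (T + E x)
       - (T + x) * (t x * (1 + E x))\<^sup>2 - 16 / 3 * (T + E x)\<^sup>2"
      unfolding H2_def using TE0 by (simp add: divide_simps) algebra
    also have "\<dots> = (1 + E x)\<^sup>2 * (4 / 3) * (2 * x * (1 - y) * (1 - (2 + 2 / 3 * x) * y)
          + (y * E x - x) * ((4 + 4 * x + 4 / 3 * x\<^sup>2) * y - 1))"
      unfolding t_def by (subst (1 2 3 4) Ty) algebra
    also have "\<dots> \<ge> 0"
      using dkw_quadratic_nonneg[of x y] x unfolding E_def[symmetric]
      by (intro mult_nonneg_nonneg) (auto simp: E_def)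
    finally show ?thesis using TE0 by (simp add: zero_le_mult_iff)
  qed
  have H10: "H1 0 = 0" using T by (simp add: H1_def E_def t_def)
  have H0: "H 0 = 0" by (simp add: H_def E_def)
  have H1: "H1 x \<ge> 0" if x: "0 \<le> x" "x < 1" for x
  proof -
    have "H1 0 \<le> H1 x"
    proof (rule DERIV_nonneg_imp_increasing_open[OF x(1)])
      show "\<exists>y. (H1 has_real_derivative y) (at z) \<and> 0 \<le> y" if "0 < z" "z < x" for z
        using dH1[of z] H2[of z] that x by auto
      show "continuous_on {0..x} H1"
        using dH1 by (intro continuous_at_imp_continuous_on ballI DERIV_isCont) auto
    qed
    thus ?thesis by (simp add: H10)
  qed
  have "H 0 \<le> H e"
  proof (rule DERIV_nonneg_imp_increasing_open[OF e(1)])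
    show "\<exists>y. (H has_real_derivative y) (at z) \<and> 0 \<le> y" if "0 < z" "z < e" for z
      using dH[of z] H1[of z] that e by auto
    show "continuous_on {0..e} H"
      using dH by (intro continuous_at_imp_continuous_on ballI DERIV_isCont) auto
  qed
  moreover have "ln (1 + E e / T) = ln (T + E e) - ln T"
  proof -
    have "1 + E e / T = (T + E e) / T" using T by (simp add: field_simps)
    thus ?thesis using T TE[OF e(1)] by (simp add: ln_div)
  qed
  ultimately show ?thesis unfolding H0 unfolding H_def by (simp add: E_def)
qed

text \<open>Likelihood comparison at a crossing: of \<open>n\<close> observations, \<open>m\<close>
  lie in the lower region, of mass \<open>F\<close> before and \<open>1 - (1 - F) * g\<close> after
  the shift, and each of the others has its likelihood multiplied by \<open>g\<close>. The total
  ratio is \<open>R ^ m * g ^ n\<close> with \<open>R \<ge> 1\<close>, hence increasing in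
  \<open>m\<close>; the worst case is the exact crossing level \<open>n * (F + e)\<close>, where
  \<open>dkw_exponent\<close> applies. For \<open>F = 0\<close> the crossing forces
  \<open>m > 0\<close> and the left side vanishes.\<close>

lemma dkw_weight:
  fixes F e g :: real
  assumes F: "0 \<le> F" and e: "0 < e" "e \<le> 1"
    and m: "m \<le> n" "real n * (F + e) \<le> real m"
  defines "g \<equiv> exp (- (2 * e + 2 / 3 * e\<^sup>2))"
  shows "F ^ m \<le> exp (- 2 * real n * e\<^sup>2) * ((1 - (1 - F) * g) ^ m * g ^ (n - m))"
proof (cases "n = 0")
  case True
  then show ?thesis using m by simp
next
  case n: False
  define \<theta> where "\<theta> = 2 * e + 2 / 3 * e\<^sup>2"
  have g: "g = exp (- \<theta>)" by (simp add: g_def \<theta>_def)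
  have \<theta>: "\<theta> \<ge> 0" using e by (simp add: \<theta>_def)
  have g01: "0 < g" "g \<le> 1" using \<theta> by (auto simp: g)
  show ?thesis
  proof (cases "F = 0")
    case True
    have "0 < real n * e" using n e by simp
    hence "m \<noteq> 0" using m True by auto
    then show ?thesis using True g01 by (auto simp: zero_power intro!: mult_nonneg_nonneg)
  next
    case False
    hence F0: "F > 0" using F by simp
    define R where "R = 1 + (exp \<theta> - 1) / F"
    have R1: "R \<ge> 1" using F0 \<theta> by (simp add: R_def)
    have R: "1 - (1 - F) * g = F * R * g"
      using F0 by (simp add: R_def g exp_minus field_simps)
    have "real n * (\<theta> + 2 * e\<^sup>2) \<le> real n * ((F + e) * ln R)"
      using dkw_exponent[OF F0, of e] e by (intro mult_left_mono) (auto simp: \<theta>_def R_def)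
    also have "\<dots> \<le> real m * ln R"
      using m(2) R1 mult_right_mono[of "real n * (F + e)" "real m" "ln R"] by (simp add: mult.assoc)
    finally have "exp (real n * (\<theta> + 2 * e\<^sup>2)) \<le> exp (real m * ln R)" by simp
    also have "\<dots> = R ^ m" using R1 by (simp add: exp_of_nat_mult)
    finally have "exp (real n * (\<theta> + 2 * e\<^sup>2)) \<le> R ^ m" .
    hence "1 \<le> exp (- 2 * real n * e\<^sup>2) * (R ^ m * g ^ n)"
      unfolding g by (simp add: field_simps exp_minus exp_add flip: exp_of_nat_mult)
    hence "F ^ m * 1 \<le> F ^ m * (exp (- 2 * real n * e\<^sup>2) * (R ^ m * g ^ n))"
      using F0 by (intro mult_left_mono) auto
    also have "g ^ n = g ^ m * g ^ (n - m)" using m by (simp flip: power_add)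
    finally show ?thesis unfolding R by (simp add: power_mult_distrib mult_ac)
  qed
qed

text \<open>
  Let \<open>A j\<close> be the event that \<open>j\<close> is the largest crossing index. It depends on the cells \<open>c i\<close> only
  through \<open>max (c i) j\<close>, so under \<open>q\<close> its probability is at least \<open>exp (2 n e\<^sup>2)\<close> times the one under
  \<open>p\<close>, by \<open>dkw_weight\<close>; summing over \<open>j\<close> gives the bound.
\<close>

theorem dkw_finite:
  fixes p :: "nat \<Rightarrow> real" and e :: real
  assumes J: "finite J" and p: "\<And>b. 0 \<le> p b" "(\<Sum>b\<le>M. p b) = 1" and e: "0 < e" "e \<le> 1"
  shows "(\<Sum>c\<in>{c \<in> J \<rightarrow>\<^sub>E {..M}. \<exists>j\<le>M. real (card J) * ((\<Sum>b\<le>j. p b) + e) \<le> real (card {i\<in>J. c i \<le> j})}.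
            \<Prod>i\<in>J. p (c i)) \<le> exp (- 2 * real (card J) * e\<^sup>2)"
proof -
  define g where "g = exp (- (2 * e + 2 / 3 * e\<^sup>2))"
  define q where "q = (\<lambda>b::nat. (if b = 0 then 1 - g else 0) + g * p b)"
  define F where "F = (\<lambda>j. \<Sum>b\<le>j. p b)"
  define cross where "cross = (\<lambda>c j. real (card J) * (F j + e) \<le> real (card {i\<in>J. c i \<le> j}))"
  \<comment> \<open>Taking the largest crossing makes the event blind to the arrangement of
    observations among the cells up to \<open>j\<close>. Only the total mass of those cells enters,
    and that is where \<open>q\<close> has its extra mass.\<close>
  define A where "A = (\<lambda>j. {c \<in> J \<rightarrow>\<^sub>E {..M}. cross c j \<and> (\<forall>j'\<in>{j<..M}. \<not> cross c j')})"
  define X where "X = {c \<in> J \<rightarrow>\<^sub>E {..M}. \<exists>j\<le>M. cross c j}"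
  have "0 \<le> 2 * e + 2 / 3 * e\<^sup>2" using e by simp
  hence g: "0 < g" "g \<le> 1" unfolding g_def by auto
  have q0: "q b \<ge> 0" for b using g p(1)[of b] by (simp add: q_def)
  have Fq: "(\<Sum>b\<le>j. q b) = 1 - (1 - F j) * g" for j
    by (simp add: q_def sum.distrib F_def sum_distrib_left algebra_simps)
  have F0: "F j \<ge> 0" for j by (simp add: F_def p sum_nonneg)
  have fin: "finite (J \<rightarrow>\<^sub>E {..M})" using J by (intro finite_PiE) auto
  have XA: "X = (\<Union>j\<le>M. A j)"
  proof
    show "X \<subseteq> (\<Union>j\<le>M. A j)"
    proof
      fix c assume c: "c \<in> X"
      define K where "K = {j. j \<le> M \<and> cross c j}"
      have K: "finite K" "K \<noteq> {}" using c by (auto simp: K_def X_def)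
      have "\<not> cross c j'" if "Max K < j'" "j' \<le> M" for j'
      proof
        assume "cross c j'"
        hence "j' \<in> K" using that by (simp add: K_def)
        thus False using Max_ge[OF K(1)] that by (meson leD)
      qed
      moreover have "Max K \<le> M" "cross c (Max K)" using Max_in[OF K] by (simp_all add: K_def)
      ultimately have "c \<in> A (Max K)" using c by (simp add: A_def X_def)
      thus "c \<in> (\<Union>j\<le>M. A j)" using Max_in[OF K] by (auto simp: K_def)
    qed
  qed (auto simp: A_def X_def)
  have disj: "A j \<inter> A j' = {}" if "j \<noteq> j'" "j \<le> M" "j' \<le> M" for j j'
    using that by (cases "j < j'") (auto simp: A_def)
  have finA: "finite (A j)" for j unfolding A_def using fin by simp
  have sumX: "(\<Sum>c\<in>X. f c) = (\<Sum>j\<le>M. \<Sum>c\<in>A j. f c)" for f :: "_ \<Rightarrow> real"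
    unfolding XA by (intro sum.UNION_disjoint) (auto simp: finA disj)
  have step: "(\<Sum>c\<in>A j. \<Prod>i\<in>J. p (c i)) \<le> exp (- 2 * real (card J) * e\<^sup>2) * (\<Sum>c\<in>A j. \<Prod>i\<in>J. q (c i))"
    if j: "j \<le> M" for j
  proof -
    define \<kappa> where "\<kappa> = (\<lambda>c. \<lambda>i\<in>J. max (c i) j)"
    have fibre: "{c \<in> A j. \<kappa> c = d} = (\<Pi>\<^sub>E i\<in>J. {b\<in>{..M}. max b j = d i})" if d: "d \<in> \<kappa> ` A j" for d
    proof -
      from d obtain c0 where c0: "c0 \<in> A j" "d = \<kappa> c0" by auto
      have cr: "cross c j' \<longleftrightarrow> cross d j'" if "\<forall>i\<in>J. max (c i) j = d i" "j \<le> j'" for c j'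
      proof -
        have "{i\<in>J. c i \<le> j'} = {i\<in>J. d i \<le> j'}" using that by (auto simp: max_def split: if_splits)
        thus ?thesis by (simp add: cross_def)
      qed
      have d0: "\<forall>i\<in>J. max (c0 i) j = d i" by (simp add: c0 \<kappa>_def)
      show ?thesis
      proof (intro equalityI subsetI)
        fix c assume "c \<in> (\<Pi>\<^sub>E i\<in>J. {b\<in>{..M}. max b j = d i})"
        hence c: "c \<in> J \<rightarrow>\<^sub>E {..M}" "\<forall>i\<in>J. max (c i) j = d i" by (auto simp: PiE_iff)
        have "c \<in> A j" using c(1) c0(1) cr[OF c(2)] cr[OF d0] by (auto simp: A_def)
        moreover have "\<kappa> c = d" using c(2) by (auto simp: \<kappa>_def c0 fun_eq_iff)
        ultimately show "c \<in> {c \<in> A j. \<kappa> c = d}" by simp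
      qed (auto simp: A_def \<kappa>_def PiE_iff)
    qed
    have sumA: "(\<Sum>c\<in>A j. \<Prod>i\<in>J. f (c i)) = (\<Sum>d\<in>\<kappa> ` A j. \<Prod>i\<in>J. \<Sum>b\<in>{b\<in>{..M}. max b j = d i}. f b)"
      for f :: "nat \<Rightarrow> real"
    proof -
      have "(\<Sum>c\<in>A j. \<Prod>i\<in>J. f (c i)) = (\<Sum>d\<in>\<kappa> ` A j. \<Sum>c\<in>{c \<in> A j. \<kappa> c = d}. \<Prod>i\<in>J. f (c i))"
        by (rule sum.image_gen[OF finA])
      also have "\<dots> = (\<Sum>d\<in>\<kappa> ` A j. \<Prod>i\<in>J. \<Sum>b\<in>{b\<in>{..M}. max b j = d i}. f b)"
        by (intro sum.cong refl) (subst prod_sum_PiE, auto simp: J fibre)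
      finally show ?thesis .
    qed
    have "(\<Prod>i\<in>J. \<Sum>b\<in>{b\<in>{..M}. max b j = d i}. p b)
        \<le> exp (- 2 * real (card J) * e\<^sup>2) * (\<Prod>i\<in>J. \<Sum>b\<in>{b\<in>{..M}. max b j = d i}. q b)"
      if d: "d \<in> \<kappa> ` A j" for d
    proof -
      from d obtain c0 where c0: "c0 \<in> A j" "d = \<kappa> c0" by auto
      have dJ: "j \<le> d i" "d i \<le> M" if "i \<in> J" for i
        using that c0 j by (auto simp: \<kappa>_def A_def PiE_iff)
      define S where "S = {i\<in>J. d i = j}"
      have SJ: "S \<subseteq> J" "finite S" using J by (auto simp: S_def)
      have "{i\<in>J. c0 i \<le> j} = S" by (auto simp: S_def c0 \<kappa>_def)
      hence cr: "real (card J) * (F j + e) \<le> real (card S)"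
        using c0(1) by (auto simp: A_def cross_def)
      have sp: "(\<Prod>i\<in>J. \<Sum>b\<in>{b\<in>{..M}. max b j = d i}. f b) = (\<Sum>b\<le>j. f b) ^ card S * (\<Prod>i\<in>J-S. f (d i))"
        for f :: "nat \<Rightarrow> real"
      proof -
        have "(\<Prod>i\<in>J. \<Sum>b\<in>{b\<in>{..M}. max b j = d i}. f b)
          = (\<Prod>i\<in>J-S. \<Sum>b\<in>{b\<in>{..M}. max b j = d i}. f b) * (\<Prod>i\<in>S. \<Sum>b\<in>{b\<in>{..M}. max b j = d i}. f b)"
          using SJ J by (intro prod.subset_diff)
        also have "(\<Prod>i\<in>S. \<Sum>b\<in>{b\<in>{..M}. max b j = d i}. f b) = (\<Prod>i\<in>S. \<Sum>b\<le>j. f b)"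
          using j by (intro prod.cong sum.cong) (auto simp: S_def)
        also have "(\<Prod>i\<in>J-S. \<Sum>b\<in>{b\<in>{..M}. max b j = d i}. f b) = (\<Prod>i\<in>J-S. f (d i))"
        proof (intro prod.cong refl)
          fix i assume i: "i \<in> J - S"
          hence "{b\<in>{..M}. max b j = d i} = {d i}" using dJ[of i] by (auto simp: S_def max_def split: if_splits)
          thus "(\<Sum>b\<in>{b\<in>{..M}. max b j = d i}. f b) = f (d i)" by simp
        qed
        finally show ?thesis by (simp add: mult_ac)
      qed
      have nS: "card (J - S) = card J - card S" using SJ by (simp add: card_Diff_subset)
      \<comment> \<open>Outside \<open>S\<close> the observations lie strictly above cell
        \<open>j\<close>, hence not in cell 0, the only cell that gains mass; their likelihood ratio
        is exactly \<open>g\<close>.\<close>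
      have "(\<Prod>i\<in>J-S. q (d i)) = (\<Prod>i\<in>J-S. g * p (d i))"
      proof (intro prod.cong refl)
        fix i assume "i \<in> J - S"
        hence "d i \<noteq> 0" using dJ[of i] by (auto simp: S_def)
        thus "q (d i) = g * p (d i)" by (simp add: q_def)
      qed
      also have "\<dots> = g ^ (card J - card S) * (\<Prod>i\<in>J-S. p (d i))"
        by (simp add: prod.distrib nS)
      finally have qS: "(\<Prod>i\<in>J-S. q (d i)) = g ^ (card J - card S) * (\<Prod>i\<in>J-S. p (d i))" .
      have "F j ^ card S \<le> exp (- 2 * real (card J) * e\<^sup>2) * ((1 - (1 - F j) * g) ^ card S * g ^ (card J - card S))"
        unfolding g_def using F0 e cr SJ J by (intro dkw_weight) (auto intro: card_mono)
      hence "F j ^ card S * (\<Prod>i\<in>J-S. p (d i)) \<le>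
          exp (- 2 * real (card J) * e\<^sup>2) * ((1 - (1 - F j) * g) ^ card S * g ^ (card J - card S)) * (\<Prod>i\<in>J-S. p (d i))"
        by (intro mult_right_mono prod_nonneg) (auto simp: p)
      thus ?thesis unfolding sp qS Fq by (simp add: F_def mult_ac)
    qed
    thus ?thesis unfolding sumA sum_distrib_left by (intro sum_mono)
  qed
  have "(\<Sum>c\<in>X. \<Prod>i\<in>J. p (c i)) \<le> exp (- 2 * real (card J) * e\<^sup>2) * (\<Sum>c\<in>X. \<Prod>i\<in>J. q (c i))"
    unfolding sumX sum_distrib_left[of _ _ "{..M}"] by (intro sum_mono step) auto
  also have "(\<Sum>c\<in>X. \<Prod>i\<in>J. q (c i)) \<le> (\<Sum>c\<in>J \<rightarrow>\<^sub>E {..M}. \<Prod>i\<in>J. q (c i))"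
    using fin q0 by (intro sum_mono2) (auto simp: X_def intro!: prod_nonneg)
  also have "\<dots> = (\<Prod>i\<in>J. \<Sum>b\<le>M. q b)"
    using J by (intro prod_sum_PiE[symmetric]) auto
  also have "\<dots> = 1" using p(2) by (simp add: Fq F_def)
  finally show ?thesis by (simp add: X_def cross_def F_def)
qed

section \<open>From finitely many cells to countable chains of measurable sets\<close>

lemma borel_measurable_card_Collect:
  assumes "finite J" and "\<And>i. i \<in> J \<Longrightarrow> {x \<in> space M. Q i x} \<in> sets M"
  shows "(\<lambda>x. real (card {i\<in>J. Q i x})) \<in> borel_measurable M"
proof -
  have "real (card {i\<in>J. Q i x}) = (\<Sum>i\<in>J. if Q i x then 1 else 0)" for x
    using assms(1) by (simp add: sum.If_cases Int_def)
  thus ?thesis using assms by (auto intro!: borel_measurable_sum measurable_If)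
qed

text \<open>Label each point by the number of chain members that miss it. Because the sets are
  nested, every member becomes an initial segment of these labels, with end \<open>L A\<close>, so
  the statement is about finitely many cells and \<open>dkw_finite\<close> applies to their joint
  law.\<close>

lemma (in prob_space) dkw_finite_chain:
  fixes e :: real
  assumes J: "finite J" and ind: "indep_vars (\<lambda>_. N) X J"
    and dist: "\<And>i. i \<in> J \<Longrightarrow> distr M N (X i) = P"
    and fin: "finite \<A>" and sets: "\<A> \<subseteq> sets N"
    and chain: "\<And>A B. A \<in> \<A> \<Longrightarrow> B \<in> \<A> \<Longrightarrow> A \<subseteq> B \<or> B \<subseteq> A"
    and e: "0 < e" "e \<le> 1"
  shows "prob {\<omega>\<in>space M. \<exists>A\<in>\<A>. real (card J) * (measure P A + e) \<le> real (card {i\<in>J. X i \<omega> \<in> A})}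
    \<le> exp (- 2 * real (card J) * e\<^sup>2)"
proof (cases "J = {}")
  case False
  then obtain i0 where i0: "i0 \<in> J" by auto
  have rv: "X i \<in> measurable M N" if "i \<in> J" for i
    using ind that by (auto simp: indep_vars_def)
  interpret P: prob_space P using prob_space_distr[OF rv[OF i0]] dist[OF i0] by simp
  have setsP: "sets P = sets N" using dist[OF i0] by auto
  have spP: "space P = space N" by (rule sets_eq_imp_space_eq[OF setsP])
  define cell where "cell = (\<lambda>x. card {A\<in>\<A>. x \<notin> A})"
  define L where "L = (\<lambda>A. card {B\<in>\<A>. \<not> A \<subseteq> B})"
  have cell_le: "cell x \<le> card \<A>" "L A \<le> card \<A>" for x A
    using fin by (auto simp: cell_def L_def intro!: card_mono)
  have cell_iff: "x \<in> A \<longleftrightarrow> cell x \<le> L A" if A: "A \<in> \<A>" for x A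
  proof
    assume "x \<in> A"
    thus "cell x \<le> L A" unfolding cell_def L_def using fin by (intro card_mono) auto
  next
    assume le: "cell x \<le> L A"
    show "x \<in> A"
    proof (rule ccontr)
      assume "x \<notin> A"
      hence "insert A {B\<in>\<A>. \<not> A \<subseteq> B} \<subseteq> {B\<in>\<A>. x \<notin> B}" using A chain by blast
      hence "card (insert A {B\<in>\<A>. \<not> A \<subseteq> B}) \<le> cell x" unfolding cell_def using fin by (intro card_mono) auto
      thus False using le fin by (auto simp: L_def card_insert_if)
    qed
  qed
  have cell_meas: "{x \<in> space N. cell x = b} \<in> sets N" for b
  proof -
    have "real (cell x) = (\<Sum>A\<in>\<A>. 1 - indicator A x)" for x
    proof -
      have "(\<Sum>A\<in>\<A>. 1 - indicator A x) = (\<Sum>A\<in>\<A>. if x \<notin> A then 1 else 0 :: real)"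
        by (intro sum.cong) auto
      thus ?thesis using fin by (simp add: cell_def sum.If_cases Int_def)
    qed
    moreover have "(\<lambda>x. \<Sum>A\<in>\<A>. 1 - indicator A x :: real) \<in> borel_measurable N"
      using sets by (intro borel_measurable_sum borel_measurable_diff borel_measurable_indicator) auto
    ultimately have "{x \<in> space N. real (cell x) = real b} \<in> sets N" by simp
    thus ?thesis by simp
  qed
  define p where "p = (\<lambda>b. P.prob {x \<in> space N. cell x = b})"
  have sum_p: "(\<Sum>b\<le>j. p b) = P.prob {x \<in> space N. cell x \<le> j}" for j
  proof -
    have "(\<Sum>b\<le>j. p b) = P.prob (\<Union>b\<le>j. {x \<in> space N. cell x = b})"
      unfolding p_def by (intro P.finite_measure_finite_Union[symmetric])
        (auto simp: setsP cell_meas disjoint_family_on_def)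
    also have "(\<Union>b\<le>j. {x \<in> space N. cell x = b}) = {x \<in> space N. cell x \<le> j}" by auto
    finally show ?thesis .
  qed
  have p1: "(\<Sum>b\<le>card \<A>. p b) = 1" unfolding sum_p using P.prob_space by (simp add: cell_le spP)
  have pA: "measure P A = (\<Sum>b\<le>L A. p b)" if "A \<in> \<A>" for A
  proof -
    have "A = {x \<in> space N. cell x \<le> L A}"
      using that sets cell_iff[OF that] sets.sets_into_space[of A N] by auto
    thus ?thesis by (simp add: sum_p)
  qed
  define \<X> where "\<X> = {c \<in> J \<rightarrow>\<^sub>E {..card \<A>}. \<exists>j\<le>card \<A>. real (card J) * ((\<Sum>b\<le>j. p b) + e) \<le> real (card {i\<in>J. c i \<le> j})}"
  define ev where "ev = (\<lambda>c. \<Inter>i\<in>J. X i -` {x \<in> space N. cell x = c i} \<inter> space M)"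
  have finX: "finite \<X>" unfolding \<X>_def using J by (intro finite_subset[OF _ finite_PiE]) auto
  have ev: "prob (ev c) = (\<Prod>i\<in>J. p (c i))" for c
  proof -
    have "prob (ev c) = (\<Prod>i\<in>J. prob (X i -` {x \<in> space N. cell x = c i} \<inter> space M))"
      unfolding ev_def using J False by (intro indep_varsD_finite[OF ind]) (auto simp: cell_meas)
    also have "\<dots> = (\<Prod>i\<in>J. p (c i))"
    proof (intro prod.cong refl)
      fix i assume i: "i \<in> J"
      show "prob (X i -` {x \<in> space N. cell x = c i} \<inter> space M) = p (c i)"
        using measure_distr[OF rv[OF i] cell_meas, of "c i"] by (simp add: p_def dist[OF i])
    qed
    finally show ?thesis .
  qed
  have ev_sets: "ev c \<in> events" for c
    unfolding ev_def using J False rv cell_meas by (intro sets.finite_INT measurable_sets) auto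
  have "{\<omega>\<in>space M. \<exists>A\<in>\<A>. real (card J) * (measure P A + e) \<le> real (card {i\<in>J. X i \<omega> \<in> A})} \<subseteq> (\<Union>c\<in>\<X>. ev c)"
  proof safe
    fix \<omega> A assume \<omega>: "\<omega> \<in> space M" and A: "A \<in> \<A>"
      and le: "real (card J) * (measure P A + e) \<le> real (card {i\<in>J. X i \<omega> \<in> A})"
    define c where "c = (\<lambda>i\<in>J. cell (X i \<omega>))"
    have "{i\<in>J. X i \<omega> \<in> A} = {i\<in>J. c i \<le> L A}" using cell_iff[OF A] by (auto simp: c_def)
    hence "real (card J) * ((\<Sum>b\<le>L A. p b) + e) \<le> real (card {i\<in>J. c i \<le> L A})"
      using le by (simp add: pA[OF A])
    moreover have "c \<in> J \<rightarrow>\<^sub>E {..card \<A>}" using cell_le by (auto simp: c_def)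
    ultimately have "c \<in> \<X>" using cell_le unfolding \<X>_def by blast
    moreover have "\<omega> \<in> ev c" using \<omega> measurable_space[OF rv \<omega>] False by (auto simp: ev_def c_def)
    ultimately show "\<omega> \<in> (\<Union>c\<in>\<X>. ev c)" by auto
  qed
  hence "prob {\<omega>\<in>space M. \<exists>A\<in>\<A>. real (card J) * (measure P A + e) \<le> real (card {i\<in>J. X i \<omega> \<in> A})}
    \<le> prob (\<Union>c\<in>\<X>. ev c)" using ev_sets finX by (intro finite_measure_mono) auto
  also have "\<dots> \<le> (\<Sum>c\<in>\<X>. prob (ev c))"
    using finX ev_sets by (intro finite_measure_subadditive_finite) auto
  also have "\<dots> \<le> exp (- 2 * real (card J) * e\<^sup>2)"
    unfolding ev \<X>_def using J e p1 by (intro dkw_finite) (auto simp: p_def)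
  finally show ?thesis .
qed simp

text \<open>
  Stated for chains of sets rather than for half-lines so that one statement covers both tails, and with no lower bound on
  \<open>e\<close>.
\<close>

theorem (in prob_space) dkw_chain:
  fixes e :: real
  assumes J: "finite J" and ind: "indep_vars (\<lambda>_. N) X J"
    and dist: "\<And>i. i \<in> J \<Longrightarrow> distr M N (X i) = P"
    and cnt: "countable \<A>" and sets: "\<A> \<subseteq> sets N"
    and chain: "\<And>A B. A \<in> \<A> \<Longrightarrow> B \<in> \<A> \<Longrightarrow> A \<subseteq> B \<or> B \<subseteq> A"
    and e: "0 \<le> e"
  shows "prob {\<omega>\<in>space M. \<exists>A\<in>\<A>. real (card J) * (measure P A + e) \<le> real (card {i\<in>J. X i \<omega> \<in> A})}
    \<le> exp (- 2 * real (card J) * e\<^sup>2)"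
proof -
  define S where "S = (\<lambda>A. {\<omega>\<in>space M. real (card J) * (measure P A + e) \<le> real (card {i\<in>J. X i \<omega> \<in> A})})"
  have rv: "X i \<in> measurable M N" if "i \<in> J" for i
    using ind that by (auto simp: indep_vars_def)
  have S: "S A \<in> events" if "A \<in> \<A>" for A
  proof -
    have "(\<lambda>\<omega>. real (card {i\<in>J. X i \<omega> \<in> A})) \<in> borel_measurable M"
    proof (intro borel_measurable_card_Collect J)
      fix i assume "i \<in> J"
      hence "X i -` A \<inter> space M \<in> events" using that sets by (intro measurable_sets[OF rv]) auto
      thus "{\<omega> \<in> space M. X i \<omega> \<in> A} \<in> events" by (simp add: vimage_def Int_def conj_commute)
    qed
    thus ?thesis unfolding S_def by simp
  qed
  \<comment> \<open>The finite version covers \<open>0 < e \<le> 1\<close>. For \<open>e = 0\<close>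
    or no observations the bound is 1; for \<open>e > 1\<close> an empirical frequency cannot reach
    the level and the event is empty. In the main case the countable chain is exhausted by finite
    subfamilies, using continuity from below.\<close>
  consider "J = {} \<or> e = 0" | "J \<noteq> {}" "e > 1" | "\<A> = {}" | "0 < e" "e \<le> 1" "\<A> \<noteq> {}" using e by linarith
  hence "prob (\<Union>A\<in>\<A>. S A) \<le> exp (- 2 * real (card J) * e\<^sup>2)"
  proof cases
    case 2
    have "S A = {}" for A
    proof -
      have "real (card {i\<in>J. X i \<omega> \<in> A}) \<le> real (card J)" for \<omega> using J by (simp add: card_mono)
      moreover have "real (card J) * 1 < real (card J) * (measure P A + e)"
        using 2 J measure_nonneg[of P A] by (intro mult_strict_left_mono; linarith?) (simp add: card_gt_0_iff)
      ultimately have "real (card {i\<in>J. X i \<omega> \<in> A}) < real (card J) * (measure P A + e)" for \<omega>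
        by (metis le_less_trans mult.right_neutral)
      thus ?thesis by (auto simp: S_def not_le)
    qed
    thus ?thesis by simp
  next
    case 4
    define f where "f = from_nat_into \<A>"
    have f: "range f = \<A>" unfolding f_def using 4 cnt by (simp add: range_from_nat_into)
    have fin: "prob (\<Union>i\<le>n. S (f i)) \<le> exp (- 2 * real (card J) * e\<^sup>2)" for n
    proof -
      have fA: "f ` {..n} \<subseteq> \<A>" using f by auto
      have "(\<Union>i\<le>n. S (f i)) = {\<omega>\<in>space M. \<exists>A\<in>f ` {..n}. real (card J) * (measure P A + e) \<le> real (card {i\<in>J. X i \<omega> \<in> A})}"
        by (auto simp: S_def)
      also have "prob \<dots> \<le> exp (- 2 * real (card J) * e\<^sup>2)"
        using fA sets by (intro dkw_finite_chain[OF J ind dist] chain 4) auto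
      finally show ?thesis .
    qed
    have "(\<lambda>n. prob (\<Union>i\<le>n. S (f i))) \<longlonglongrightarrow> prob (\<Union>n. \<Union>i\<le>n. S (f i))"
    proof (rule finite_Lim_measure_incseq)
      have "S (f i) \<in> events" for i using S f by blast
      thus "range (\<lambda>n. \<Union>i\<le>n. S (f i)) \<subseteq> events" by auto
      show "incseq (\<lambda>n. \<Union>i\<le>n. S (f i))" unfolding incseq_def by (intro allI impI UN_mono) auto
    qed
    hence "prob (\<Union>n. \<Union>i\<le>n. S (f i)) \<le> exp (- 2 * real (card J) * e\<^sup>2)"
      using fin by (intro LIMSEQ_le_const2) auto
    also have "(\<Union>n. \<Union>i\<le>n. S (f i)) = (\<Union>A\<in>\<A>. S A)" using f by auto
    finally show ?thesis .
  qed auto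
  also have "(\<Union>A\<in>\<A>. S A) = {\<omega>\<in>space M. \<exists>A\<in>\<A>. real (card J) * (measure P A + e) \<le> real (card {i\<in>J. X i \<omega> \<in> A})}"
    by (auto simp: S_def)
  finally show ?thesis .
qed

text \<open>Conditioning independent coordinates on a box keeps them independent: numerator and
  denominator both factor over the coordinates. This is how fixing the labels leaves the features
  independent. Outside \<open>I\<close> the factor is conditioned on the whole space, so that every
  factor is a probability measure.\<close>

lemma uniform_measure_PiM:
  assumes I: "finite I" and P: "prob_space P"
    and B: "\<And>i. i \<in> I \<Longrightarrow> B i \<in> sets P" "\<And>i. i \<in> I \<Longrightarrow> emeasure P (B i) \<noteq> 0"
  shows "uniform_measure (PiM I (\<lambda>_. P)) (PiE I B) = PiM I (\<lambda>i. uniform_measure P (if i \<in> I then B i else space P))"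
proof -
  interpret PP: prob_space P by fact
  define B' where "B' = (\<lambda>i. if i \<in> I then B i else space P)"
  have B': "B' i \<in> sets P" "emeasure P (B' i) \<noteq> 0" "emeasure P (B' i) \<noteq> \<infinity>" for i
    using B PP.emeasure_space_1 by (auto simp: B'_def)
  interpret U: prob_space "uniform_measure P (B' i)" for i
    using B' by (intro prob_space_uniform_measure)
  interpret prd: product_prob_space "\<lambda>_. P" I by unfold_locales
  interpret UU: product_sigma_finite "\<lambda>i. uniform_measure P (B' i)" by unfold_locales
  have PB: "PiE I B = PiE I B'" by (intro PiE_cong) (auto simp: B'_def)
  have "uniform_measure (PiM I (\<lambda>_. P)) (PiE I B') = PiM I (\<lambda>i. uniform_measure P (B' i))"
  proof (rule UU.PiM_eqI[OF I])
    show "sets (uniform_measure (PiM I (\<lambda>_. P)) (PiE I B')) = sets (PiM I (\<lambda>i. uniform_measure P (B' i)))"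
      by (simp cong: sets_PiM_cong)
    fix A assume "\<And>i. i \<in> I \<Longrightarrow> A i \<in> sets (uniform_measure P (B' i))"
    hence A: "\<And>i. i \<in> I \<Longrightarrow> A i \<in> sets P" by simp
    have "emeasure (uniform_measure (PiM I (\<lambda>_. P)) (PiE I B')) (PiE I A)
        = emeasure (PiM I (\<lambda>_. P)) (PiE I (\<lambda>i. B' i \<inter> A i)) / emeasure (PiM I (\<lambda>_. P)) (PiE I B')"
      using A B' I by (subst emeasure_uniform_measure) (auto simp: PiE_Int intro!: sets_PiM_I_finite)
    also have "\<dots> = (\<Prod>i\<in>I. emeasure P (B' i \<inter> A i)) / (\<Prod>i\<in>I. emeasure P (B' i))"
      using A B' I by (simp add: prd.emeasure_PiM)
    also have "\<dots> = (\<Prod>i\<in>I. emeasure P (B' i \<inter> A i) / emeasure P (B' i))"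
    proof -
      have "0 < PP.prob (B' i)" for i using B'(2)[of i] by (simp add: PP.emeasure_eq_measure zero_less_measure_iff)
      thus ?thesis by (simp add: PP.emeasure_eq_measure prod_ennreal divide_ennreal prod_pos prod_nonneg prod_dividef)
    qed
    also have "\<dots> = (\<Prod>i\<in>I. emeasure (uniform_measure P (B' i)) (A i))"
      using A B' by (intro prod.cong) auto
    finally show "emeasure (uniform_measure (PiM I (\<lambda>_. P)) (PiE I B')) (PiE I A) = (\<Prod>i\<in>I. emeasure (uniform_measure P (B' i)) (A i))" .
  qed
  thus ?thesis by (simp add: PB B'_def)
qed

text \<open>Under the product measure conditioned on the box, the coordinates in \<open>J\<close>
  are i.i.d. with law \<open>P\<close> given \<open>B0\<close>, so \<open>dkw_chain\<close> applies.
  Multiplying by the mass of the box gives the undivided form that is later summed over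
  boxes.\<close>

lemma dkw_PiM_conditional:
  fixes e :: real
  assumes I: "finite I" "J \<subseteq> I" and P: "prob_space P"
    and B: "\<And>i. i \<in> I \<Longrightarrow> B i \<in> sets P" "\<And>i. i \<in> I \<Longrightarrow> measure P (B i) \<noteq> 0" "\<And>i. i \<in> J \<Longrightarrow> B i = B0"
    and cnt: "countable \<A>" and sets: "\<A> \<subseteq> sets P"
    and chain: "\<And>A B. A \<in> \<A> \<Longrightarrow> B \<in> \<A> \<Longrightarrow> A \<subseteq> B \<or> B \<subseteq> A"
    and e: "0 \<le> e"
  shows "measure (PiM I (\<lambda>_. P)) {z \<in> PiE I B. \<exists>A\<in>\<A>. real (card J) * (measure P (B0 \<inter> A) / measure P B0 + e)
        \<le> real (card {i\<in>J. z i \<in> A})}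
    \<le> exp (- 2 * real (card J) * e\<^sup>2) * measure (PiM I (\<lambda>_. P)) (PiE I B)" (is "measure ?M ?S \<le> _")
proof (cases "J = {}")
  case True
  interpret PP: prob_space P by fact
  interpret prd: product_prob_space "\<lambda>_. P" I by unfold_locales
  show ?thesis using True I B(1) by (auto intro!: prd.P.finite_measure_mono sets_PiM_I_finite)
next
  case False
  then obtain j0 where j0: "j0 \<in> J" by auto
  interpret PP: prob_space P by fact
  interpret prd: product_prob_space "\<lambda>_. P" I by unfold_locales
  have B0: "B0 \<in> sets P" "measure P B0 \<noteq> 0" using B j0 I by fastforce+
  define B' where "B' = (\<lambda>i. if i \<in> I then B i else space P)"
  have B': "B' i \<in> sets P" "emeasure P (B' i) \<noteq> 0" "emeasure P (B' i) \<noteq> \<infinity>" for i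
    using B PP.emeasure_space_1 by (auto simp: B'_def PP.emeasure_eq_measure)
  define U where "U = uniform_measure ?M (PiE I B)"
  have Ueq: "U = PiM I (\<lambda>i. uniform_measure P (B' i))"
    unfolding U_def B'_def using I P B by (intro uniform_measure_PiM) (auto simp: PP.emeasure_eq_measure)
  have WM: "PiE I B \<in> sets ?M" using I B by (intro sets_PiM_I_finite) auto
  have "emeasure ?M (PiE I B) = ennreal (\<Prod>i\<in>I. measure P (B i))"
    using I B by (simp add: prd.emeasure_PiM PP.emeasure_eq_measure prod_ennreal)
  moreover have "(\<Prod>i\<in>I. measure P (B i)) > 0" using B by (intro prod_pos) (simp add: zero_less_measure_iff)
  ultimately have WB: "emeasure ?M (PiE I B) \<noteq> 0" "measure ?M (PiE I B) \<noteq> 0"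
    by (auto simp: measure_def)
  interpret U: prob_space U unfolding Ueq by (intro prob_space_PiM prob_space_uniform_measure B')
  have setsU: "sets U = sets ?M" by (simp add: U_def)
  have spU: "space U = space ?M" by (simp add: U_def)
  have comp: "(\<lambda>z. z i) \<in> measurable U P" if "i \<in> I" for i
    using that by (simp add: measurable_cong_sets[OF setsU refl])
  have distU: "distr U P (\<lambda>z. z i) = uniform_measure P (B' i)" if "i \<in> I" for i
  proof -
    have "distr U P (\<lambda>z. z i) = distr U (uniform_measure P (B' i)) (\<lambda>z. z i)" by (intro distr_cong) auto
    also have "\<dots> = uniform_measure P (B' i)" unfolding Ueq
      using that by (intro distr_PiM_component prob_space_uniform_measure B')
    finally show ?thesis .
  qed
  have ind: "U.indep_vars (\<lambda>_. P) (\<lambda>i z. z i) I"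
  proof (subst U.indep_vars_iff_distr_eq_PiM')
    show "I \<noteq> {}" using False I by auto
    have "distr U ?M (\<lambda>x. \<lambda>i\<in>I. x i) = distr U U (\<lambda>x. x)"
      by (intro distr_cong) (auto simp: setsU spU space_PiM)
    also have "\<dots> = PiM I (\<lambda>i. uniform_measure P (B' i))" by (simp add: Ueq)
    also have "\<dots> = PiM I (\<lambda>i. distr U P (\<lambda>z. z i))" by (intro PiM_cong refl) (simp add: distU)
    finally show "distr U ?M (\<lambda>x. \<lambda>i\<in>I. x i) = PiM I (\<lambda>i. distr U P (\<lambda>z. z i))" .
  qed (rule comp)
  define T where "T = {z\<in>space U. \<exists>A\<in>\<A>. real (card J) * (measure (uniform_measure P B0) A + e) \<le> real (card {i\<in>J. z i \<in> A})}"
  have bound: "measure U T \<le> exp (- 2 * real (card J) * e\<^sup>2)"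
    unfolding T_def
  proof (rule U.dkw_chain[OF _ U.indep_vars_subset[OF ind I(2)]])
    show "finite J" using I by (rule finite_subset[rotated])
    show "distr U P (\<lambda>z. z i) = uniform_measure P B0" if "i \<in> J" for i
    proof -
      have "i \<in> I" using that I by auto
      thus ?thesis using B(3)[OF that] by (simp add: distU B'_def)
    qed
  qed (use cnt sets chain e in auto)
  have "T = (\<Union>A\<in>\<A>. {z\<in>space ?M. real (card J) * (measure (uniform_measure P B0) A + e) \<le> real (card {i\<in>J. z i \<in> A})})"
    by (auto simp: T_def spU)
  also have "\<dots> \<in> sets ?M"
  proof (intro sets.countable_UN'' cnt)
    fix A assume A: "A \<in> \<A>"
    have "(\<lambda>z. real (card {i\<in>J. z i \<in> A})) \<in> borel_measurable ?M"
    proof (intro borel_measurable_card_Collect finite_subset[OF I(2,1)])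
      fix i assume "i \<in> J"
      hence "(\<lambda>z. z i) -` A \<inter> space ?M \<in> sets ?M"
        using A sets I by (intro measurable_sets[OF measurable_component_singleton]) auto
      thus "{z \<in> space ?M. z i \<in> A} \<in> sets ?M" by (simp add: vimage_def Int_def conj_commute)
    qed
    thus "{z\<in>space ?M. real (card J) * (measure (uniform_measure P B0) A + e) \<le> real (card {i\<in>J. z i \<in> A})} \<in> sets ?M"
      by simp
  qed
  finally have TM: "T \<in> sets ?M" .
  have um: "measure (uniform_measure P B0) A = measure P (B0 \<inter> A) / measure P B0" if "A \<in> \<A>" for A
    using that sets B0 by (intro measure_uniform_measure) (auto simp: PP.emeasure_eq_measure)
  have mU: "measure U T = measure ?M (PiE I B \<inter> T) / measure ?M (PiE I B)"
    unfolding U_def using WB TM prd.P.emeasure_finite by (intro measure_uniform_measure) auto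
  have "?S = PiE I B \<inter> T"
    unfolding T_def spU using um B(1)[THEN sets.sets_into_space]
    by (auto simp: space_PiM PiE_iff extensional_def)
  hence "measure ?M ?S = measure U T * measure ?M (PiE I B)"
    using WB(2) by (simp add: mU)
  also have "\<dots> \<le> exp (- 2 * real (card J) * e\<^sup>2) * measure ?M (PiE I B)"
    using bound by (intro mult_right_mono) auto
  finally show ?thesis .
qed

text \<open>
  \<open>U\<close> plays the role of the training data, on which the chain of sets may depend, and \<open>B\<close> fixes the labels of
  the calibration sample.
\<close>

lemma (in prob_space)
  fixes e :: real and R :: "'q \<Rightarrow> ('u \<times> 'z) set"
  assumes I: "finite I" "J \<subseteq> I" and P: "prob_space P"
    and U: "U \<in> measurable M MU" and Z: "Z \<in> measurable M (PiM I (\<lambda>_. P))"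
    and joint: "distr M (MU \<Otimes>\<^sub>M PiM I (\<lambda>_. P)) (\<lambda>\<omega>. (U \<omega>, Z \<omega>)) = distr M MU U \<Otimes>\<^sub>M PiM I (\<lambda>_. P)"
    and dist: "distr M (PiM I (\<lambda>_. P)) Z = PiM I (\<lambda>_. P)"
    and B: "\<And>i. i \<in> I \<Longrightarrow> B i \<in> sets P" "\<And>i. i \<in> I \<Longrightarrow> measure P (B i) \<noteq> 0"
      "\<And>i. i \<in> J \<Longrightarrow> B i = B0" and B0: "B0 \<in> sets P"
    and Q: "countable Q" and R: "\<And>q. q \<in> Q \<Longrightarrow> R q \<in> sets (MU \<Otimes>\<^sub>M P)"
    and chain: "\<And>u q q'. u \<in> space MU \<Longrightarrow> q \<in> Q \<Longrightarrow> q' \<in> Q \<Longrightarrow>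
      Pair u -` R q \<subseteq> Pair u -` R q' \<or> Pair u -` R q' \<subseteq> Pair u -` R q"
    and e: "0 \<le> e"
  shows dkw_conditional_sets: "{\<omega>\<in>space M. (\<forall>i\<in>I. Z \<omega> i \<in> B i) \<and> (\<exists>q\<in>Q.
        real (card J) * (measure P (B0 \<inter> Pair (U \<omega>) -` R q) / measure P B0 + e)
        \<le> real (card {i\<in>J. (U \<omega>, Z \<omega> i) \<in> R q}))} \<in> events" (is "?E \<in> events")
    and dkw_conditional: "prob {\<omega>\<in>space M. (\<forall>i\<in>I. Z \<omega> i \<in> B i) \<and> (\<exists>q\<in>Q.
        real (card J) * (measure P (B0 \<inter> Pair (U \<omega>) -` R q) / measure P B0 + e)
        \<le> real (card {i\<in>J. (U \<omega>, Z \<omega> i) \<in> R q}))}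
      \<le> exp (- 2 * real (card J) * e\<^sup>2) * prob {\<omega>\<in>space M. \<forall>i\<in>I. Z \<omega> i \<in> B i}"
proof -
  interpret PP: prob_space P by fact
  interpret prd: product_prob_space "\<lambda>_. P" I by unfold_locales
  let ?M = "PiM I (\<lambda>_. P)"
  note [measurable] = U Z
  define T where "T = {(u, z) \<in> space (MU \<Otimes>\<^sub>M ?M). (\<forall>i\<in>I. z i \<in> B i) \<and> (\<exists>q\<in>Q.
        real (card J) * (measure P (B0 \<inter> Pair u -` R q) / measure P B0 + e)
        \<le> real (card {i\<in>J. (u, z i) \<in> R q}))}"
  have T: "T \<in> sets (MU \<Otimes>\<^sub>M ?M)"
  proof -
    define TB where "TB = {w \<in> space (MU \<Otimes>\<^sub>M ?M). \<forall>i\<in>I. snd w i \<in> B i}"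
    define TR where "TR = (\<lambda>q. {w \<in> space (MU \<Otimes>\<^sub>M ?M).
        real (card J) * (measure P (B0 \<inter> Pair (fst w) -` R q) / measure P B0 + e)
        \<le> real (card {i\<in>J. (fst w, snd w i) \<in> R q})})"
    have "TB \<in> sets (MU \<Otimes>\<^sub>M ?M)"
      unfolding TB_def
    proof (rule sets.sets_Collect_finite_All[OF _ I(1)])
      fix i assume i: "i \<in> I"
      have "(\<lambda>w. snd w i) -` B i \<inter> space (MU \<Otimes>\<^sub>M ?M) \<in> sets (MU \<Otimes>\<^sub>M ?M)"
        using i B(1)[OF i] by (intro measurable_sets[of _ _ P]) measurable
      thus "{w \<in> space (MU \<Otimes>\<^sub>M ?M). snd w i \<in> B i} \<in> sets (MU \<Otimes>\<^sub>M ?M)"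
        by (simp add: vimage_def Int_def conj_commute)
    qed
    moreover have "TR q \<in> sets (MU \<Otimes>\<^sub>M ?M)" if q: "q \<in> Q" for q
    proof -
      have "(\<lambda>w. real (card {i\<in>J. (fst w, snd w i) \<in> R q})) \<in> borel_measurable (MU \<Otimes>\<^sub>M ?M)"
      proof (intro borel_measurable_card_Collect finite_subset[OF I(2,1)])
        fix i assume "i \<in> J"
        hence i: "i \<in> I" using I by auto
        have "(\<lambda>w. (fst w, snd w i)) -` R q \<inter> space (MU \<Otimes>\<^sub>M ?M) \<in> sets (MU \<Otimes>\<^sub>M ?M)"
          using i R[OF q] by (intro measurable_sets[of _ _ "MU \<Otimes>\<^sub>M P"]) measurable
        thus "{w \<in> space (MU \<Otimes>\<^sub>M ?M). (fst w, snd w i) \<in> R q} \<in> sets (MU \<Otimes>\<^sub>M ?M)"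
          by (simp add: vimage_def Int_def conj_commute)
      qed
      moreover have "(\<lambda>u. measure P (B0 \<inter> Pair u -` R q)) \<in> borel_measurable MU"
      proof -
        have "(space MU \<times> B0) \<inter> R q \<in> sets (MU \<Otimes>\<^sub>M P)" using R[OF q] B0 by auto
        from PP.measurable_emeasure_Pair[OF this]
        have "(\<lambda>u. measure P (Pair u -` ((space MU \<times> B0) \<inter> R q))) \<in> borel_measurable MU"
          unfolding measure_def by measurable
        thus ?thesis by (rule measurable_cong[THEN iffD1, rotated]) (auto intro!: arg_cong[where f="measure P"])
      qed
      ultimately show ?thesis unfolding TR_def by measurable
    qed
    ultimately have "TB \<inter> (\<Union>q\<in>Q. TR q) \<in> sets (MU \<Otimes>\<^sub>M ?M)"
      using Q by (intro sets.Int sets.countable_UN') auto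
    also have "TB \<inter> (\<Union>q\<in>Q. TR q) = T" by (auto simp: TB_def TR_def T_def)
    finally show ?thesis .
  qed
  have UZ: "(\<lambda>\<omega>. (U \<omega>, Z \<omega>)) \<in> measurable M (MU \<Otimes>\<^sub>M ?M)" by measurable
  have sp: "U \<omega> \<in> space MU" "Z \<omega> \<in> space ?M" if "\<omega> \<in> space M" for \<omega>
    using that measurable_space[OF U] measurable_space[OF Z] by auto
  have ET: "?E = (\<lambda>\<omega>. (U \<omega>, Z \<omega>)) -` T \<inter> space M"
    using sp by (auto simp: T_def space_pair_measure)
  show "?E \<in> events" unfolding ET by (rule measurable_sets[OF UZ T])
  have W: "PiE I B \<in> sets ?M" using I B by (intro sets_PiM_I_finite) auto
  have WZ: "{\<omega>\<in>space M. \<forall>i\<in>I. Z \<omega> i \<in> B i} = Z -` PiE I B \<inter> space M"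
    using sp by (auto simp: space_PiM PiE_iff)
  interpret DU: prob_space "distr M MU U" by (rule prob_space_distr) simp
  have "emeasure M ?E = emeasure (distr M (MU \<Otimes>\<^sub>M ?M) (\<lambda>\<omega>. (U \<omega>, Z \<omega>))) T"
    unfolding ET using UZ T by (simp add: emeasure_distr)
  also have "distr M (MU \<Otimes>\<^sub>M ?M) (\<lambda>\<omega>. (U \<omega>, Z \<omega>)) = distr M MU U \<Otimes>\<^sub>M ?M"
    by (rule joint)
  \<comment> \<open>Fubini with the training part \<open>u\<close> outside: each section has a fixed
    chain, and the bound obtained for it does not depend on \<open>u\<close>, so it survives
    integration.\<close>
  also have "emeasure (distr M MU U \<Otimes>\<^sub>M ?M) T = (\<integral>\<^sup>+u. emeasure ?M (Pair u -` T) \<partial>distr M MU U)"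
    using T by (intro prd.P.emeasure_pair_measure_alt) (simp cong: sets_pair_measure_cong)
  also have "\<dots> \<le> (\<integral>\<^sup>+u. ennreal (exp (- 2 * real (card J) * e\<^sup>2) * measure ?M (PiE I B)) \<partial>distr M MU U)"
  proof (intro nn_integral_mono)
    fix u assume "u \<in> space (distr M MU U)"
    hence u: "u \<in> space MU" by simp
    have "Pair u -` T = {z \<in> PiE I B. \<exists>A\<in>(\<lambda>q. Pair u -` R q) ` Q. real (card J) * (measure P (B0 \<inter> A) / measure P B0 + e)
        \<le> real (card {i\<in>J. z i \<in> A})}"
      using u B(1)[THEN sets.sets_into_space] by (auto simp: T_def space_pair_measure space_PiM PiE_iff)
    also have "measure ?M \<dots> \<le> exp (- 2 * real (card J) * e\<^sup>2) * measure ?M (PiE I B)"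
    proof (intro dkw_PiM_conditional I P B e)
      show "A \<subseteq> A' \<or> A' \<subseteq> A" if "A \<in> (\<lambda>q. Pair u -` R q) ` Q" "A' \<in> (\<lambda>q. Pair u -` R q) ` Q" for A A'
      proof -
        from that obtain q q' where "q \<in> Q" "q' \<in> Q" and A: "A = Pair u -` R q" "A' = Pair u -` R q'" by blast
        from chain[OF u this(1,2)] show ?thesis unfolding A .
      qed
    qed (use Q R in \<open>auto intro: sets_Pair1\<close>)
    finally show "emeasure ?M (Pair u -` T) \<le> ennreal (exp (- 2 * real (card J) * e\<^sup>2) * measure ?M (PiE I B))"
      by (simp add: prd.P.emeasure_eq_measure ennreal_leI)
  qed
  also have "\<dots> = ennreal (exp (- 2 * real (card J) * e\<^sup>2) * measure ?M (PiE I B))"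
    by (simp add: DU.emeasure_space_1[simplified])
  also have "measure ?M (PiE I B) = prob {\<omega>\<in>space M. \<forall>i\<in>I. Z \<omega> i \<in> B i}"
    unfolding WZ using measure_distr[OF Z W] by (simp add: dist)
  finally show "prob ?E \<le> exp (- 2 * real (card J) * e\<^sup>2) * prob {\<omega>\<in>space M. \<forall>i\<in>I. Z \<omega> i \<in> B i}"
    by (simp add: emeasure_eq_measure)
qed

section \<open>Order statistics and thresholds\<close>

lemma sort_nth_le_iff:
  fixes xs :: "'a::linorder list"
  assumes m: "m < length xs"
  shows "sort xs ! m \<le> t \<longleftrightarrow> m < length (filter (\<lambda>x. x \<le> t) xs)"
proof -
  define ys where "ys = sort xs"
  have ys: "sorted ys" "length ys = length xs" by (simp_all add: ys_def)
  have "length (filter (\<lambda>x. x \<le> t) xs) = length (filter (\<lambda>x. x \<le> t) ys)"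
    by (metis ys_def mset_filter mset_sort size_mset)
  also have "\<dots> = card {i. i < length ys \<and> ys ! i \<le> t}" by (rule length_filter_conv_card)
  finally have len: "length (filter (\<lambda>x. x \<le> t) xs) = card {i. i < length ys \<and> ys ! i \<le> t}" .
  show ?thesis
  proof (cases "ys ! m \<le> t")
    case True
    have "{..m} \<subseteq> {i. i < length ys \<and> ys ! i \<le> t}"
      using True m ys sorted_nth_mono[OF ys(1)] by (auto intro: order_trans)
    hence "card {..m} \<le> card {i. i < length ys \<and> ys ! i \<le> t}" by (intro card_mono) auto
    thus ?thesis using True by (simp add: len ys_def)
  next
    case False
    have "{i. i < length ys \<and> ys ! i \<le> t} \<subseteq> {..<m}"
    proof safe
      fix i assume i: "i < length ys" "ys ! i \<le> t"
      show "i < m"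
      proof (rule ccontr)
        assume "\<not> i < m"
        hence "ys ! m \<le> ys ! i" using i by (intro sorted_nth_mono[OF ys(1)]) auto
        thus False using i False by simp
      qed
    qed
    hence "card {i. i < length ys \<and> ys ! i \<le> t} \<le> card {..<m}" by (intro card_mono) auto
    thus ?thesis using False by (simp add: len ys_def)
  qed
qed

text \<open>Replaces sorting by counting, ties included. Both the measurability of the order
  statistics and the comparison of \<open>i\<close> with the empirical distribution function rest on
  it.\<close>

lemma ostat_le_iff:
  assumes "finite Dcal" "i \<in> {1..ncount Dcal D k}"
  shows "ostat s Dcal D k i \<le> t \<longleftrightarrow> i \<le> card {j \<in> cal_idx Dcal D k. s (fst (D j)) k \<le> t}"
proof -
  have fin: "finite (cal_idx Dcal D k)" using assms(1) by (simp add: cal_idx_def)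
  let ?js = "sorted_list_of_set (cal_idx Dcal D k)"
  have "ostat s Dcal D k i \<le> t \<longleftrightarrow> i - 1 < length (filter (\<lambda>x. x \<le> t) (map (\<lambda>j. s (fst (D j)) k) ?js))"
    unfolding ostat_def using assms(2) by (intro sort_nth_le_iff) (auto simp: ncount_def)
  also have "length (filter (\<lambda>x. x \<le> t) (map (\<lambda>j. s (fst (D j)) k) ?js)) = length (filter (\<lambda>j. s (fst (D j)) k \<le> t) ?js)"
    by (simp add: filter_map comp_def)
  also have "\<dots> = card {j \<in> cal_idx Dcal D k. s (fst (D j)) k \<le> t}"
    using fin by (subst distinct_length_filter) (auto intro!: arg_cong[where f=card])
  finally show ?thesis using assms(2) by auto
qed

lemma ostat_mem:
  assumes "finite Dcal" "i \<in> {1..ncount Dcal D k}"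
  shows "ostat s Dcal D k i \<in> (\<lambda>j. s (fst (D j)) k) ` cal_idx Dcal D k"
proof -
  have fin: "finite (cal_idx Dcal D k)" using assms(1) by (simp add: cal_idx_def)
  let ?xs = "map (\<lambda>j. s (fst (D j)) k) (sorted_list_of_set (cal_idx Dcal D k))"
  have "ostat s Dcal D k i \<in> set (sort ?xs)"
    unfolding ostat_def using assms(2) by (intro nth_mem) (auto simp: ncount_def)
  thus ?thesis using fin by simp
qed

lemma tauhat_cc_unit_interval:
  assumes "finite Dcal" "\<And>x. s x k \<in> {0..1}"
  shows "tauhat_cc K V \<alpha> \<gamma> s Dcal D k \<in> {0..1}"
proof (cases "Ihat K V \<alpha> \<gamma> s Dcal D k = {}")
  case False
  have "finite (Ihat K V \<alpha> \<gamma> s Dcal D k)" by (simp add: Ihat_def)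
  hence "Min (Ihat K V \<alpha> \<gamma> s Dcal D k) \<in> Ihat K V \<alpha> \<gamma> s Dcal D k" using False by (rule Min_in)
  hence "Min (Ihat K V \<alpha> \<gamma> s Dcal D k) \<in> {1..ncount Dcal D k}" by (simp add: Ihat_def)
  from ostat_mem[OF assms(1) this, of s] assms(2) show ?thesis using False by (auto simp: tauhat_cc_def)
qed (simp add: tauhat_cc_def)

text \<open>The all-ones vector puts 1 into the set whose infimum is taken, so the infimum is that
  of a nonempty bounded set. The upper bound 1 is what makes the fallback threshold 1 cover
  everything.\<close>

lemma cscore_unit_interval:
  assumes C: "is_prediction_function K C" and k: "k \<in> {1..K}"
  shows "cscore K C x k \<in> {0..1}"
proof -
  define S where "S = {\<tau> k | \<tau>. thr_vec K \<tau> \<and> k \<in> C x \<tau>}"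
  have S01: "S \<subseteq> {0..1}" using k by (auto simp: S_def thr_vec_def)
  have "thr_vec K (\<lambda>_. 1)" by (simp add: thr_vec_def)
  moreover from this have "k \<in> C x (\<lambda>_. 1)" using C k unfolding is_prediction_function_def by blast
  ultimately have "1 \<in> S" unfolding S_def by force
  moreover have "bdd_below S" using S01 by (intro bdd_belowI[of _ 0]) auto
  ultimately have "Inf S \<le> 1" by (intro cInf_lower)
  moreover have "0 \<le> Inf S" using S01 \<open>1 \<in> S\<close> by (intro cInf_greatest) auto
  ultimately show ?thesis by (simp add: cscore_def S_def)
qed

text \<open>Lets the random calibration labels be replaced by the fixed assignment \<open>y\<close>
  on \<open>W y\<close>, where \<open>tauhat_cc_measurable\<close> can be used.\<close>

lemma tauhat_cc_cong:
  assumes "\<And>i. i \<in> Dcal \<Longrightarrow> D i = D' i"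
  shows "tauhat_cc K V \<alpha> \<gamma> s Dcal D k = tauhat_cc K V \<alpha> \<gamma> s Dcal D' k"
proof -
  have idx: "cal_idx Dcal D l = cal_idx Dcal D' l" for l
    using assms by (auto simp: cal_idx_def)
  have nc: "ncount Dcal D l = ncount Dcal D' l" for l by (simp add: ncount_def idx)
  have nm: "nmin K Dcal D = nmin K Dcal D'" by (simp add: nmin_def nc)
  have "{i \<in> cal_idx Dcal D' l. s (fst (D i)) k \<le> t} = {i \<in> cal_idx Dcal D' l. s (fst (D' i)) k \<le> t}" for l t
    using assms by (auto simp: cal_idx_def)
  hence Fh: "Fhat s Dcal D k l t = Fhat s Dcal D' k l t" for l t by (simp add: Fhat_def idx nc)
  have "map (\<lambda>j. s (fst (D j)) k) (sorted_list_of_set (cal_idx Dcal D' k))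
      = map (\<lambda>j. s (fst (D' j)) k) (sorted_list_of_set (cal_idx Dcal D' k))"
  proof (cases "finite (cal_idx Dcal D' k)")
    case True
    thus ?thesis using assms by (intro map_cong) (auto simp: cal_idx_def)
  qed simp
  hence os: "ostat s Dcal D k i = ostat s Dcal D' k i" for i
    unfolding ostat_def idx by (simp only:)
  have "Ihat K V \<alpha> \<gamma> s Dcal D k = Ihat K V \<alpha> \<gamma> s Dcal D' k"
    by (simp add: Ihat_def nc nm os Deltahat_def Fh)
  thus ?thesis by (simp add: tauhat_cc_def os)
qed

text \<open>With the labels fixed, the index sets, counts and \<open>delta_cc\<close> are constants
  and only the scores vary, so the selection rule involves finitely many measurable
  comparisons.\<close>

lemma tauhat_cc_measurable:
  fixes s :: "'w \<Rightarrow> 'x \<Rightarrow> nat \<Rightarrow> real"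
  assumes fin: "finite Dcal" and lab: "\<And>i \<omega>. i \<in> Dcal \<Longrightarrow> snd (D \<omega> i) = y i"
    and meas: "\<And>i. i \<in> Dcal \<Longrightarrow> (\<lambda>\<omega>. s \<omega> (fst (D \<omega> i)) k) \<in> borel_measurable M"
  shows "(\<lambda>\<omega>. tauhat_cc K V \<alpha> \<gamma> (s \<omega>) Dcal (D \<omega>) k) \<in> borel_measurable M"
proof -
  define J where "J = (\<lambda>l. {i\<in>Dcal. y i = l})"
  have idx: "cal_idx Dcal (D \<omega>) l = J l" for \<omega> l using lab by (auto simp: cal_idx_def J_def)
  have finJ: "finite (J l)" for l using fin by (simp add: J_def)
  have nc: "ncount Dcal (D \<omega>) l = card (J l)" for \<omega> l by (simp add: ncount_def idx)
  have nm: "nmin K Dcal (D \<omega>) = Min ((\<lambda>l. card (J l)) ` {1..K})" for \<omega> by (simp add: nmin_def nc)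
  have Fh: "(\<lambda>\<omega>. Fhat (s \<omega>) Dcal (D \<omega>) k l (t \<omega>)) \<in> borel_measurable M"
    if t[measurable]: "t \<in> borel_measurable M" for l t
    unfolding Fhat_def idx nc
  proof (intro borel_measurable_divide borel_measurable_const borel_measurable_card_Collect finJ)
    fix i assume "i \<in> J l"
    hence [measurable]: "(\<lambda>\<omega>. s \<omega> (fst (D \<omega> i)) k) \<in> borel_measurable M" using meas by (simp add: J_def)
    show "{\<omega> \<in> space M. s \<omega> (fst (D \<omega> i)) k \<le> t \<omega>} \<in> sets M" by measurable
  qed
  have os[measurable]: "(\<lambda>\<omega>. ostat (s \<omega>) Dcal (D \<omega>) k i) \<in> borel_measurable M" if i: "i \<in> {1..card (J k)}" for i
  proof (rule borel_measurableI_le)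
    fix t
    have "(\<lambda>\<omega>. real (card {j \<in> J k. s \<omega> (fst (D \<omega> j)) k \<le> t})) \<in> borel_measurable M"
    proof (intro borel_measurable_card_Collect finJ)
      fix j assume "j \<in> J k"
      hence [measurable]: "(\<lambda>\<omega>. s \<omega> (fst (D \<omega> j)) k) \<in> borel_measurable M" using meas by (simp add: J_def)
      show "{\<omega> \<in> space M. s \<omega> (fst (D \<omega> j)) k \<le> t} \<in> sets M" by simp
    qed
    hence "{\<omega> \<in> space M. real i \<le> real (card {j \<in> J k. s \<omega> (fst (D \<omega> j)) k \<le> t})} \<in> sets M"
      by (intro borel_measurable_le borel_measurable_const)
    thus "{\<omega> \<in> space M. ostat (s \<omega>) Dcal (D \<omega>) k i \<le> t} \<in> sets M"
      using i by (simp add: ostat_le_iff[OF fin] idx nc)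
  qed
  define Q where "Q = (\<lambda>i \<omega>. i \<in> Ihat K V \<alpha> \<gamma> (s \<omega>) Dcal (D \<omega>) k)"
  have Q[measurable]: "Measurable.pred M (Q i)" for i
  proof (cases "i \<in> {1..card (J k)}")
    case True
    have D: "(\<lambda>\<omega>. Deltahat K V (s \<omega>) Dcal (D \<omega>) k (ostat (s \<omega>) Dcal (D \<omega>) k i)) \<in> borel_measurable M"
      unfolding Deltahat_def
      by (intro borel_measurable_add borel_measurable_sum borel_measurable_times borel_measurable_const Fh os[OF True])
    have "Q i = (\<lambda>\<omega>. 1 - \<alpha> - Deltahat K V (s \<omega>) Dcal (D \<omega>) k (ostat (s \<omega>) Dcal (D \<omega>) k i)
        + delta_cc K V k (card (J k)) (Min ((\<lambda>l. card (J l)) ` {1..K})) \<gamma> \<le> real i / real (card (J k)))"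
      unfolding Q_def Ihat_def nc nm using True by (intro ext) blast
    thus ?thesis unfolding pred_def using D
      by (simp only:) (intro borel_measurable_le borel_measurable_add borel_measurable_diff borel_measurable_const)
  next
    case False
    hence "Q i = (\<lambda>_. False)" unfolding Q_def Ihat_def nc by (intro ext) blast
    thus ?thesis by simp
  qed
  let ?n = "card (J k)"
  \<comment> \<open>The order statistic at a random minimal index becomes a finite sum in which
    exactly one term, the first admissible index, is switched on.\<close>
  have eq: "tauhat_cc K V \<alpha> \<gamma> (s \<omega>) Dcal (D \<omega>) k =
     (if \<forall>i\<in>{1..?n}. \<not> Q i \<omega> then 1 else
      (\<Sum>i\<in>{1..?n}. if Q i \<omega> \<and> (\<forall>i'\<in>{1..<i}. \<not> Q i' \<omega>) then ostat (s \<omega>) Dcal (D \<omega>) k i else 0))" for \<omega>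
  proof (cases "Ihat K V \<alpha> \<gamma> (s \<omega>) Dcal (D \<omega>) k = {}")
    case True
    thus ?thesis by (simp add: tauhat_cc_def Q_def)
  next
    case False
    define m where "m = Min (Ihat K V \<alpha> \<gamma> (s \<omega>) Dcal (D \<omega>) k)"
    have finI: "finite (Ihat K V \<alpha> \<gamma> (s \<omega>) Dcal (D \<omega>) k)" by (simp add: Ihat_def)
    have m: "Q m \<omega>" unfolding Q_def m_def using finI False by (rule Min_in)
    have sub: "i \<in> {1..?n}" if "Q i \<omega>" for i using that by (simp add: Q_def Ihat_def nc)
    have le: "m \<le> i" if "Q i \<omega>" for i unfolding m_def using finI that by (simp add: Q_def)
    have "(Q i \<omega> \<and> (\<forall>i'\<in>{1..<i}. \<not> Q i' \<omega>)) \<longleftrightarrow> i = m" if "i \<in> {1..?n}" for i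
    proof
      assume *: "Q i \<omega> \<and> (\<forall>i'\<in>{1..<i}. \<not> Q i' \<omega>)"
      have "\<not> m < i" using * m sub[OF m] by auto
      thus "i = m" using le * by (meson le_antisym not_le)
    next
      assume "i = m"
      thus "Q i \<omega> \<and> (\<forall>i'\<in>{1..<i}. \<not> Q i' \<omega>)" using m le by (auto simp: not_le[symmetric])
    qed
    hence "(\<Sum>i\<in>{1..?n}. if Q i \<omega> \<and> (\<forall>i'\<in>{1..<i}. \<not> Q i' \<omega>) then ostat (s \<omega>) Dcal (D \<omega>) k i else 0)
        = (\<Sum>i\<in>{1..?n}. if i = m then ostat (s \<omega>) Dcal (D \<omega>) k i else 0)"
      by (intro sum.cong) auto
    also have "\<dots> = ostat (s \<omega>) Dcal (D \<omega>) k m" using sub[OF m] by simp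
    finally show ?thesis using False m sub[OF m] by (auto simp: tauhat_cc_def m_def)
  qed
  show ?thesis unfolding eq
    by (intro measurable_If borel_measurable_sum borel_measurable_const os pred_intros_finite pred_intros_logic Q) auto
qed


text \<open>\<open>Deltahat\<close> is built so that adding it to \<open>Fhat\<close> of class
  \<open>k\<close> yields the full \<open>V\<close>-combination. The rank satisfies
  \<open>i / n \<le> Fhat\<close> at its order statistic, with strict inequality possible under
  ties, which is the favourable direction.\<close>

lemma tauhat_cc_weighted_Fhat:
  assumes fin: "finite Dcal" and k: "k \<in> {1..K}" and ne: "Ihat K V \<alpha> \<gamma> s Dcal D k \<noteq> {}"
  defines "\<tau> \<equiv> tauhat_cc K V \<alpha> \<gamma> s Dcal D k"
  shows "1 - \<alpha> + delta_cc K V k (ncount Dcal D k) (nmin K Dcal D) \<gamma> \<le> (\<Sum>l\<in>{1..K}. V k l * Fhat s Dcal D k l \<tau>)"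
proof -
  define i where "i = Min (Ihat K V \<alpha> \<gamma> s Dcal D k)"
  have "finite (Ihat K V \<alpha> \<gamma> s Dcal D k)" by (simp add: Ihat_def)
  hence "i \<in> Ihat K V \<alpha> \<gamma> s Dcal D k" unfolding i_def using ne by (rule Min_in)
  moreover have \<tau>: "\<tau> = ostat s Dcal D k i" using ne by (simp add: \<tau>_def tauhat_cc_def i_def)
  ultimately have i: "i \<in> {1..ncount Dcal D k}"
    and ge: "1 - \<alpha> - Deltahat K V s Dcal D k \<tau> + delta_cc K V k (ncount Dcal D k) (nmin K Dcal D) \<gamma>
      \<le> real i / real (ncount Dcal D k)" by (auto simp: Ihat_def)
  have "i \<le> card {j \<in> cal_idx Dcal D k. s (fst (D j)) k \<le> \<tau>}"
    using ostat_le_iff[OF fin i, of s \<tau>] \<tau> by simp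
  hence "real i / real (ncount Dcal D k) \<le> Fhat s Dcal D k k \<tau>"
    unfolding Fhat_def by (intro divide_right_mono) auto
  with ge have "1 - \<alpha> + delta_cc K V k (ncount Dcal D k) (nmin K Dcal D) \<gamma>
      \<le> Fhat s Dcal D k k \<tau> + Deltahat K V s Dcal D k \<tau>" by simp
  also have "\<dots> = V k k * Fhat s Dcal D k k \<tau> + (\<Sum>l\<in>{1..K} - {k}. V k l * Fhat s Dcal D k l \<tau>)"
    by (simp add: Deltahat_def algebra_simps)
  also have "\<dots> = (\<Sum>l\<in>{1..K}. V k l * Fhat s Dcal D k l \<tau>)"
    by (rule sum.remove[symmetric]) (use k in auto)
  finally show ?thesis .
qed

section \<open>Deviations and contamination\<close>

text \<open>The function is the cdf of the push-forward \<open>distr M borel f\<close>, whose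
  right-continuity is standard.\<close>

lemma tendsto_measure_le_at_right:
  fixes f :: "'a \<Rightarrow> real"
  assumes M: "finite_measure M" and f[measurable]: "f \<in> borel_measurable M"
  shows "((\<lambda>t. measure M {x \<in> space M. f x \<le> t}) \<longlongrightarrow> measure M {x \<in> space M. f x \<le> a}) (at_right a)"
proof -
  interpret finite_measure M by fact
  interpret D: finite_measure "distr M borel f" by (rule finite_measure_distr) fact
  interpret B: finite_borel_measure "distr M borel f" by unfold_locales simp
  have "cdf (distr M borel f) = (\<lambda>t. measure M {x \<in> space M. f x \<le> t})"
    unfolding cdf_def by (intro ext, subst measure_distr) (auto intro!: arg_cong[where f="measure M"])
  thus ?thesis using B.cdf_is_right_cont[of a] by (simp add: continuous_within)
qed

text \<open>An empirical count is such a cdf as well, for the counting measure on the finite set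
  \<open>J\<close>.\<close>

lemma tendsto_card_le_at_right:
  fixes f :: "'a \<Rightarrow> real"
  assumes "finite J"
  shows "((\<lambda>t. real (card {i\<in>J. f i \<le> t})) \<longlongrightarrow> real (card {i\<in>J. f i \<le> a})) (at_right a)"
proof -
  have "measure (count_space J) {i\<in>J. f i \<le> t} = real (card {i\<in>J. f i \<le> t})" for t
    using assms by (subst measure_count_space) auto
  thus ?thesis
    using tendsto_measure_le_at_right[of "count_space J" f a] assms by (simp add: finite_measure_count_space)
qed

lemma le_at_right_of_Rats:
  fixes f g :: "real \<Rightarrow> real"
  assumes f: "(f \<longlongrightarrow> f a) (at_right a)" and g: "(g \<longlongrightarrow> g a) (at_right a)"
    and le: "\<And>q. q \<in> \<rat> \<Longrightarrow> f q \<le> g q"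
  shows "f a \<le> g a"
proof -
  have "\<exists>q\<in>\<rat>. a < q \<and> q < a + inverse (real (Suc n))" for n
    by (intro Rats_dense_in_real) simp
  then obtain q where q: "\<And>n. q n \<in> \<rat>" "\<And>n. a < q n" "\<And>n. q n < a + inverse (real (Suc n))" by metis
  have "q \<longlonglongrightarrow> a"
  proof (rule tendsto_sandwich[where f="\<lambda>_. a" and h="\<lambda>n. a + inverse (real (Suc n))"])
    show "(\<lambda>n. a + inverse (real (Suc n))) \<longlonglongrightarrow> a" by (rule LIMSEQ_inverse_real_of_nat_add)
  qed (use q in \<open>auto intro!: always_eventually less_imp_le simp del: of_nat_Suc\<close>)
  hence "filterlim q (at_right a) sequentially"
    using q by (auto simp: filterlim_at intro!: always_eventually)
  from filterlim_compose[OF f this] filterlim_compose[OF g this] show ?thesis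
    by (rule LIMSEQ_le) (auto simp: le q)
qed

text \<open>Weights summing to one permit centering at \<open>k\<close>: the deviation there needs
  only an upper bound, and each remaining difference of two deviations costs at most
  \<open>2 * e2\<close>. The disjunction admits the degenerate row in which all off-diagonal weights
  vanish and no control by \<open>e2\<close> is available.\<close>

lemma weighted_deviation_bound:
  fixes V F G :: "'a \<Rightarrow> real"
  assumes L: "finite L" "k \<in> L" and V: "(\<Sum>l\<in>L. V l) = 1"
    and k: "F k - G k \<le> e1"
    and l: "(\<Sum>l\<in>L - {k}. \<bar>V l\<bar>) = 0 \<or> (\<forall>l\<in>L. \<bar>F l - G l\<bar> \<le> e2)"
  shows "(\<Sum>l\<in>L. V l * F l) - (\<Sum>l\<in>L. V l * G l) \<le> e1 + 2 * (\<Sum>l\<in>L - {k}. \<bar>V l\<bar>) * e2"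
proof -
  let ?d = "\<lambda>l. F l - G l"
  have "(\<Sum>l\<in>L. V l * F l) - (\<Sum>l\<in>L. V l * G l) = (\<Sum>l\<in>L. V l * ?d l)"
    by (simp add: sum_subtractf algebra_simps)
  also have "\<dots> = (\<Sum>l\<in>L. V l) * ?d k + (\<Sum>l\<in>L. V l * (?d l - ?d k))"
    by (simp only: right_diff_distrib sum_subtractf sum_distrib_right)
  also have "(\<Sum>l\<in>L. V l * (?d l - ?d k)) = (\<Sum>l\<in>L - {k}. V l * (?d l - ?d k))"
    using L by (simp add: sum.remove)
  also have "(\<Sum>l\<in>L. V l) * ?d k + (\<Sum>l\<in>L - {k}. V l * (?d l - ?d k)) \<le> e1 + (\<Sum>l\<in>L - {k}. \<bar>V l\<bar> * (2 * e2))"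
  proof (intro add_mono sum_mono)
    show "(\<Sum>l\<in>L. V l) * ?d k \<le> e1" using k V by simp
    fix l assume l': "l \<in> L - {k}"
    show "V l * (?d l - ?d k) \<le> \<bar>V l\<bar> * (2 * e2)"
      using l
    proof
      assume "(\<Sum>l\<in>L - {k}. \<bar>V l\<bar>) = 0"
      hence "V l = 0" using L l' by (simp add: sum_nonneg_eq_0_iff)
      thus ?thesis by simp
    next
      assume *: "\<forall>l\<in>L. \<bar>?d l\<bar> \<le> e2"
      have "V l * (?d l - ?d k) \<le> \<bar>V l\<bar> * \<bar>?d l - ?d k\<bar>" by (metis abs_ge_self abs_mult)
      also have "\<dots> \<le> \<bar>V l\<bar> * (2 * e2)"
        using *[rule_format, of l] *[rule_format, of k] l' L by (intro mult_left_mono) auto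
      finally show ?thesis .
    qed
  qed
  also have "\<dots> = e1 + 2 * (\<Sum>l\<in>L - {k}. \<bar>V l\<bar>) * e2"
    by (simp add: sum_distrib_left sum_distrib_right mult_ac)
  finally show ?thesis .
qed

text \<open>The radius is calibrated to sample size \<open>m\<close> but used with
  \<open>n \<ge> m\<close> observations, which only helps because \<open>ln (1 / g) \<ge> 0\<close>.
  This is why one radius computed from the smallest class serves all classes.\<close>

lemma exp_neg_sqrt_log:
  fixes g :: real
  assumes g: "0 < g" "g \<le> 1" and n: "0 < m" "m \<le> n"
  shows "exp (- 2 * real n * (sqrt (ln (1 / g) / (2 * real m)))\<^sup>2) \<le> g"
proof -
  have l: "0 \<le> ln (1 / g)" using g by simp
  hence "(sqrt (ln (1 / g) / (2 * real m)))\<^sup>2 = ln (1 / g) / (2 * real m)" by simp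
  hence "- 2 * real n * (sqrt (ln (1 / g) / (2 * real m)))\<^sup>2 = - (real n / real m * ln (1 / g))" by simp
  also have "\<dots> \<le> - (1 * ln (1 / g))"
    using n l by (intro le_imp_neg_le mult_right_mono) (auto simp: field_simps)
  also have "\<dots> = ln g" using g by (simp add: ln_div)
  finally have "exp (- 2 * real n * (sqrt (ln (1 / g) / (2 * real m)))\<^sup>2) \<le> exp (ln g)" by simp
  thus ?thesis using g by simp
qed

text \<open>Conditional independence makes the law of the features given observed label
  \<open>l\<close> the mixture, with weights \<open>Mmat P l j\<close>, of the laws given the true
  labels \<open>j\<close>. Multiplying by \<open>V\<close> undoes the mixing.\<close>

lemma linear_contamination:
  fixes P :: "('x::topological_space \<times> nat \<times> nat) measure"
  assumes P: "prob_space P" and sets: "sets P = sets triple_space"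
    and lab: "AE z in P. fst (snd z) \<in> {1..K}"
    and ci: "cond_indep_X_Yt_given_Y K borel P" and pos: "lab_pos K P"
    and V: "is_inverse_mat K (Mmat P) V" and k: "k \<in> {1..K}" and A: "A \<in> sets borel"
  shows "measure P {z \<in> space P. fst z \<in> A \<and> fst (snd z) = k} / measure P {z \<in> space P. fst (snd z) = k}
    = (\<Sum>l\<in>{1..K}. V k l * (measure P {z \<in> space P. fst z \<in> A \<and> snd (snd z) = l} / measure P {z \<in> space P. snd (snd z) = l}))"
proof -
  interpret prob_space P by fact
  have [measurable]: "fst \<in> borel_measurable P" "(\<lambda>z. fst (snd z)) \<in> measurable P (count_space UNIV)"
      "(\<lambda>z. snd (snd z)) \<in> measurable P (count_space UNIV)"
    unfolding measurable_cong_sets[OF sets refl] triple_space_def by measurable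
  note [measurable] = A
  define a where "a = (\<lambda>j. prob {z \<in> space P. fst z \<in> A \<and> fst (snd z) = j})"
  define b where "b = (\<lambda>j. prob {z \<in> space P. fst (snd z) = j})"
  define c where "c = (\<lambda>j l. prob {z \<in> space P. fst (snd z) = j \<and> snd (snd z) = l})"
  define d where "d = (\<lambda>l. prob {z \<in> space P. snd (snd z) = l})"
  have b: "b j > 0" and d: "d j > 0" if "j \<in> {1..K}" for j using pos that by (auto simp: lab_pos_def b_def d_def)
  have step: "prob {z \<in> space P. fst z \<in> A \<and> snd (snd z) = l} / d l = (\<Sum>j\<in>{1..K}. a j / b j * Mmat P l j)"
    if l: "l \<in> {1..K}" for l
  proof -
    have "prob {z \<in> space P. fst z \<in> A \<and> snd (snd z) = l}
        = prob (\<Union>j\<in>{1..K}. {z \<in> space P. fst z \<in> A \<and> fst (snd z) = j \<and> snd (snd z) = l})"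
    proof (rule finite_measure_eq_AE)
      show "AE z in P. z \<in> {z \<in> space P. fst z \<in> A \<and> snd (snd z) = l} \<longleftrightarrow>
          z \<in> (\<Union>j\<in>{1..K}. {z \<in> space P. fst z \<in> A \<and> fst (snd z) = j \<and> snd (snd z) = l})"
        using lab by eventually_elim auto
    qed auto
    also have "\<dots> = (\<Sum>j\<in>{1..K}. prob {z \<in> space P. fst z \<in> A \<and> fst (snd z) = j \<and> snd (snd z) = l})"
      by (intro finite_measure_finite_Union) (auto simp: disjoint_family_on_def)
    also have "\<dots> = (\<Sum>j\<in>{1..K}. a j / b j * c j l)"
    proof (intro sum.cong refl)
      fix j assume j: "j \<in> {1..K}"
      show "prob {z \<in> space P. fst z \<in> A \<and> fst (snd z) = j \<and> snd (snd z) = l} = a j / b j * c j l"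
        using ci A j l b[OF j] unfolding cond_indep_X_Yt_given_Y_def a_def b_def c_def by (simp add: field_simps)
    qed
    finally show ?thesis by (simp add: sum_divide_distrib Mmat_def c_def d_def)
  qed
  have "(\<Sum>l\<in>{1..K}. V k l * (prob {z \<in> space P. fst z \<in> A \<and> snd (snd z) = l} / d l))
    = (\<Sum>l\<in>{1..K}. \<Sum>j\<in>{1..K}. a j / b j * (V k l * Mmat P l j))"
    by (intro sum.cong refl) (simp add: step sum_distrib_left mult_ac)
  also have "\<dots> = (\<Sum>j\<in>{1..K}. a j / b j * (\<Sum>l\<in>{1..K}. V k l * Mmat P l j))"
    by (subst sum.swap) (simp add: sum_distrib_left)
  \<comment> \<open>Here \<open>V\<close> acts as left inverse: row \<open>k\<close> of
    \<open>V\<close> times column \<open>j\<close> of \<open>Mmat P\<close>.\<close>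
  also have "\<dots> = (\<Sum>j\<in>{1..K}. a j / b j * (if k = j then 1 else 0))"
    using V k unfolding is_inverse_mat_def by (intro sum.cong) auto
  also have "\<dots> = (\<Sum>j\<in>{1..K}. if k = j then a j / b j else 0)" by (intro sum.cong) auto
  also have "\<dots> = a k / b k" using k by simp
  finally show ?thesis by (simp add: a_def b_def d_def)
qed

section \<open>Calibration-conditional coverage\<close>

locale contaminated_sample = prob_space \<Omega> for \<Omega> :: "'w measure" +
  fixes Xs :: "nat \<Rightarrow> 'w \<Rightarrow> real ^ 'd"
    and Ys Yt :: "nat \<Rightarrow> 'w \<Rightarrow> nat"
    and K n :: nat
    and Dtr Dcal :: "nat set"
    and Cfam :: "(nat \<Rightarrow> (real ^ 'd) \<times> nat) \<Rightarrow> real ^ 'd \<Rightarrow> (nat \<Rightarrow> real) \<Rightarrow> nat set"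
    and V :: "nat \<Rightarrow> nat \<Rightarrow> real"
    and \<alpha> \<gamma> :: real
    and k :: nat
  assumes iid_indep: "indep_vars (\<lambda>_. triple_space) (triple Xs Ys Yt) {1..n+1}"
    and iid_dist: "\<And>i. i \<in> {1..n+1} \<Longrightarrow> distr \<Omega> triple_space (triple Xs Ys Yt i)
                                  = distr \<Omega> triple_space (triple Xs Ys Yt 1)"
    and labels: "\<And>i \<omega>. i \<in> {1..n+1} \<Longrightarrow> \<omega> \<in> space \<Omega> \<Longrightarrow> Ys i \<omega> \<in> {1..K} \<and> Yt i \<omega> \<in> {1..K}"
    and A1_ci: "cond_indep_X_Yt_given_Y K borel (distr \<Omega> triple_space (triple Xs Ys Yt 1))"
    and A1_pos: "lab_pos K (distr \<Omega> triple_space (triple Xs Ys Yt 1))"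
    and V_inv: "is_inverse_mat K (Mmat (distr \<Omega> triple_space (triple Xs Ys Yt 1))) V"
    and split: "Dtr \<inter> Dcal = {}" "Dtr \<union> Dcal = {1..n}" "Dcal \<noteq> {}"
    and Cpred: "\<And>t. is_prediction_function K (Cfam t)" "\<And>t. score_convention K (Cfam t)"
    and Cmeas: "(\<lambda>(t, x). cscore K (Cfam t) x k) \<in> borel_measurable (train_space Dtr \<Otimes>\<^sub>M borel)"
    and alpha: "0 < \<alpha>" "\<alpha> < 1"
    and gamma: "0 < \<gamma>" "\<gamma> < 1"
    and k: "k \<in> {1..K}"
begin

text \<open>
  \<open>U\<close> and \<open>Z\<close> keep the unobserved true labels, so that both are restrictions of the same i.i.d. family;
  \<open>train\<close> forgets them again.
\<close>

definition P :: "((real ^ 'd) \<times> nat \<times> nat) measure" where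
  "P = distr \<Omega> triple_space (triple Xs Ys Yt 1)"

definition MU :: "(nat \<Rightarrow> (real ^ 'd) \<times> nat \<times> nat) measure" where
  "MU = PiM Dtr (\<lambda>_. triple_space)"

definition U where "U \<omega> = (\<lambda>i\<in>Dtr. triple Xs Ys Yt i \<omega>)"

definition Z where "Z \<omega> = (\<lambda>i\<in>Dcal. triple Xs Ys Yt i \<omega>)"

definition train :: "(nat \<Rightarrow> (real ^ 'd) \<times> nat \<times> nat) \<Rightarrow> nat \<Rightarrow> (real ^ 'd) \<times> nat" where
  "train u = (\<lambda>i\<in>Dtr. (fst (u i), snd (snd (u i))))"

definition score where "score u x = cscore K (Cfam (train u)) x k"

definition Ft where
  "Ft u l t = measure P {z \<in> space P. snd (snd z) = l \<and> score u (fst z) \<le> t} / measure P {z \<in> space P. snd (snd z) = l}"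

text \<open>One complete assignment of the calibration labels. The event that fixes the counts is a
  finite disjoint union of such events.\<close>

definition W where "W y = {\<omega> \<in> space \<Omega>. \<forall>i\<in>Dcal. Yt i \<omega> = y i}"

definition \<tau> where
  "\<tau> \<omega> = tauhat_cc K V \<alpha> \<gamma> (cscore K (Cfam (train (U \<omega>)))) Dcal (obsdata Xs Yt \<omega>) k"

text \<open>The coverage for class \<open>k\<close> as a functional of the data alone, with the test
  point integrated out under \<open>P\<close>; \<open>conditional_coverage_eq_cov\<close> identifies
  it with the inner quotient of the theorem.\<close>

definition cov where
  "cov \<omega> = measure P {z \<in> space P. fst (snd z) = k \<and> score (U \<omega>) (fst z) \<le> \<tau> \<omega>} / measure P {z \<in> space P. fst (snd z) = k}"

section \<open>Laws and measurability of the training and calibration blocks\<close>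

lemma finite_Dcal: "finite Dcal"
  using split(2) by (metis finite_Un finite_atLeastAtMost)

lemma Dcal_sub: "Dcal \<subseteq> {1..n+1}" and Dtr_sub: "Dtr \<subseteq> {1..n+1}"
proof -
  have "Dcal \<subseteq> {1..n}" "Dtr \<subseteq> {1..n}" using split(2) by blast+
  moreover have "{1..n} \<subseteq> {1..n+1}" by simp
  ultimately show "Dcal \<subseteq> {1..n+1}" "Dtr \<subseteq> {1..n+1}" by (meson order_trans)+
qed

lemma triple_measurable: "i \<in> {1..n+1} \<Longrightarrow> triple Xs Ys Yt i \<in> measurable \<Omega> triple_space"
  using iid_indep by (auto simp: indep_vars_def)

lemma distr_triple: "i \<in> {1..n+1} \<Longrightarrow> distr \<Omega> triple_space (triple Xs Ys Yt i) = P"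
  unfolding P_def by (rule iid_dist)

lemma sets_P: "sets P = sets triple_space" by (simp add: P_def)

lemma space_P: "space P = UNIV"
  by (simp add: P_def triple_space_def space_pair_measure)

lemma prob_space_P: "prob_space P"
  unfolding P_def by (intro prob_space_distr triple_measurable) simp

lemma P_components [measurable]:
  "fst \<in> borel_measurable P" "(\<lambda>z. fst (snd z)) \<in> measurable P (count_space UNIV)"
  "(\<lambda>z. snd (snd z)) \<in> measurable P (count_space UNIV)"
  unfolding measurable_cong_sets[OF sets_P refl] triple_space_def by measurable

lemma Xs_measurable: "i \<in> {1..n+1} \<Longrightarrow> Xs i \<in> borel_measurable \<Omega>"
  and Yt_measurable: "i \<in> {1..n+1} \<Longrightarrow> Yt i \<in> measurable \<Omega> (count_space UNIV)"
proof -
  assume i: "i \<in> {1..n+1}"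
  have "triple Xs Ys Yt i \<in> measurable \<Omega> P"
    using triple_measurable[OF i] by (simp add: measurable_cong_sets[OF refl sets_P])
  from measurable_compose[OF this P_components(1)] measurable_compose[OF this P_components(3)]
  show "Xs i \<in> borel_measurable \<Omega>" "Yt i \<in> measurable \<Omega> (count_space UNIV)"
    by (simp_all add: triple_def[abs_def])
qed

lemma U_measurable [measurable]: "U \<in> measurable \<Omega> MU"
  unfolding U_def[abs_def] MU_def using Dtr_sub by (intro measurable_restrict triple_measurable) auto

lemma Z_measurable: "Z \<in> measurable \<Omega> (PiM Dcal (\<lambda>_. P))"
  unfolding Z_def[abs_def] using Dcal_sub
  by (intro measurable_restrict) (auto simp: measurable_cong_sets[OF refl sets_P] intro!: triple_measurable)

lemma train_U: "train (U \<omega>) = train_data Dtr Xs Yt \<omega>"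
  by (auto simp: train_def U_def train_data_def triple_def)

lemma train_measurable [measurable]: "train \<in> measurable MU (train_space Dtr)"
proof -
  have "(\<lambda>u. (fst (u i), snd (snd (u i)))) \<in> measurable MU (borel \<Otimes>\<^sub>M count_space UNIV)" if "i \<in> Dtr" for i
  proof -
    have "(\<lambda>u. u i) \<in> measurable MU triple_space" unfolding MU_def using that by simp
    moreover have "(\<lambda>z. (fst z, snd (snd z))) \<in> measurable triple_space (borel \<Otimes>\<^sub>M count_space UNIV)"
      unfolding triple_space_def by measurable
    ultimately show ?thesis by (rule measurable_compose)
  qed
  thus ?thesis unfolding train_def[abs_def] train_space_def by (intro measurable_restrict)
qed

lemma score_measurable: "(\<lambda>(u, x). score u x) \<in> borel_measurable (MU \<Otimes>\<^sub>M borel)"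
proof -
  have "(\<lambda>w. (train (fst w), snd w)) \<in> measurable (MU \<Otimes>\<^sub>M borel) (train_space Dtr \<Otimes>\<^sub>M borel)" by measurable
  from measurable_compose[OF this Cmeas] show ?thesis by (simp add: score_def case_prod_beta')
qed

lemma score_measurable_comp [measurable (raw)]:
  assumes "f \<in> measurable M MU" "g \<in> borel_measurable M"
  shows "(\<lambda>w. score (f w) (g w)) \<in> borel_measurable M"
  using measurable_compose[OF measurable_Pair[OF assms] score_measurable] by simp

lemma score_unit_interval: "score u x \<in> {0..1}"
  unfolding score_def using cscore_unit_interval[OF Cpred(1) k] .

lemma distr_Z: "distr \<Omega> (PiM Dcal (\<lambda>_. P)) Z = PiM Dcal (\<lambda>_. P)"
proof -
  have "indep_vars (\<lambda>_. triple_space) (triple Xs Ys Yt) Dcal"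
    by (rule indep_vars_subset[OF iid_indep Dcal_sub])
  hence "distr \<Omega> (PiM Dcal (\<lambda>_. triple_space)) Z = PiM Dcal (\<lambda>i. distr \<Omega> triple_space (triple Xs Ys Yt i))"
    unfolding Z_def[abs_def] using split(3) Dcal_sub
    by (subst (asm) indep_vars_iff_distr_eq_PiM') (blast intro: triple_measurable[OF subsetD[OF Dcal_sub]])+
  also have "\<dots> = PiM Dcal (\<lambda>_. P)" using Dcal_sub by (intro PiM_cong) (auto simp: distr_triple)
  finally show ?thesis by (subst distr_cong) (auto simp: sets_P cong: sets_PiM_cong)
qed

text \<open>Disjoint index blocks of an independent family are independent. This is what allows the
  score, a function of \<open>U\<close>, to be held fixed against the calibration sample.\<close>

lemma distr_U_Z: "distr \<Omega> (MU \<Otimes>\<^sub>M PiM Dcal (\<lambda>_. P)) (\<lambda>\<omega>. (U \<omega>, Z \<omega>)) = distr \<Omega> MU U \<Otimes>\<^sub>M PiM Dcal (\<lambda>_. P)"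
proof -
  have s: "sets (PiM Dcal (\<lambda>_. P)) = sets (PiM Dcal (\<lambda>_. triple_space))" by (intro sets_PiM_cong) (auto simp: sets_P)
  have "indep_var (PiM Dtr (\<lambda>_. triple_space)) (\<lambda>\<omega>. restrict (\<lambda>i. triple Xs Ys Yt i \<omega>) Dtr)
      (PiM Dcal (\<lambda>_. triple_space)) (\<lambda>\<omega>. restrict (\<lambda>i. triple Xs Ys Yt i \<omega>) Dcal)"
    by (rule indep_var_restrict[OF iid_indep split(1) Dtr_sub Dcal_sub])
  hence "indep_var MU U (PiM Dcal (\<lambda>_. triple_space)) Z"
    by (simp add: MU_def U_def[abs_def] Z_def[abs_def])
  hence "distr \<Omega> MU U \<Otimes>\<^sub>M distr \<Omega> (PiM Dcal (\<lambda>_. triple_space)) Z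
      = distr \<Omega> (MU \<Otimes>\<^sub>M PiM Dcal (\<lambda>_. triple_space)) (\<lambda>\<omega>. (U \<omega>, Z \<omega>))"
    by (simp add: indep_var_distribution_eq)
  also have "distr \<Omega> (PiM Dcal (\<lambda>_. triple_space)) Z = PiM Dcal (\<lambda>_. P)"
    using distr_Z by (subst (asm) distr_cong[OF refl s refl])
  also have "distr \<Omega> (MU \<Otimes>\<^sub>M PiM Dcal (\<lambda>_. triple_space)) (\<lambda>\<omega>. (U \<omega>, Z \<omega>))
      = distr \<Omega> (MU \<Otimes>\<^sub>M PiM Dcal (\<lambda>_. P)) (\<lambda>\<omega>. (U \<omega>, Z \<omega>))"
    by (intro distr_cong sets_pair_measure_cong refl s[symmetric])
  finally show ?thesis by simp
qed

section \<open>Deviation events under fixed calibration labels\<close>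

lemma W_sets: "W y \<in> events"
  unfolding W_def using finite_Dcal Dcal_sub
  by (intro sets.sets_Collect_finite_All measurable_sets_Collect[OF Yt_measurable]) auto

text \<open>
  Rational thresholds make these events measurable; right-continuity then gives the bounds at all real thresholds.
\<close>

definition upper_dev where
  "upper_dev y l e = {\<omega> \<in> W y. \<exists>q\<in>\<rat>. real (card {i\<in>Dcal. y i = l}) * (Ft (U \<omega>) l q + e)
      \<le> real (card {i\<in>{i\<in>Dcal. y i = l}. score (U \<omega>) (Xs i \<omega>) \<le> q})}"

definition lower_dev where
  "lower_dev y l e = {\<omega> \<in> W y. \<exists>q\<in>\<rat>. real (card {i\<in>Dcal. y i = l}) * (1 - Ft (U \<omega>) l q + e)
      \<le> real (card {i\<in>{i\<in>Dcal. y i = l}. \<not> score (U \<omega>) (Xs i \<omega>) \<le> q})}"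

lemma label_prob_pos: "l \<in> {1..K} \<Longrightarrow> measure P {z \<in> space P. snd (snd z) = l} > 0"
  "l \<in> {1..K} \<Longrightarrow> measure P {z \<in> space P. fst (snd z) = l} > 0"
  using A1_pos by (auto simp: lab_pos_def P_def)

text \<open>Too few scores below \<open>t\<close> means too many above it. Passing to complements
  turns lower deviations into upper deviations along the chain of superlevel sets, so the same
  one-sided inequality covers both.\<close>

lemma Ft_compl:
  assumes u: "u \<in> space MU" and l: "l \<in> {1..K}"
  shows "measure P {z \<in> space P. snd (snd z) = l \<and> \<not> score u (fst z) \<le> t} / measure P {z \<in> space P. snd (snd z) = l} = 1 - Ft u l t"
proof -
  interpret P: prob_space P by (rule prob_space_P)
  have [measurable]: "(\<lambda>z. score u (fst z)) \<in> borel_measurable P" using u by measurable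
  have "P.prob {z \<in> space P. snd (snd z) = l} = P.prob ({z \<in> space P. snd (snd z) = l \<and> score u (fst z) \<le> t} \<union>
      {z \<in> space P. snd (snd z) = l \<and> \<not> score u (fst z) \<le> t})"
    by (intro arg_cong[where f=P.prob]) auto
  also have "\<dots> = P.prob {z \<in> space P. snd (snd z) = l \<and> score u (fst z) \<le> t}
      + P.prob {z \<in> space P. snd (snd z) = l \<and> \<not> score u (fst z) \<le> t}"
    by (intro P.finite_measure_Union) auto
  finally show ?thesis using label_prob_pos(1)[OF l] by (simp add: Ft_def field_simps)
qed

text \<open>For a fixed score, sublevel sets and superlevel sets at rational thresholds are both
  countable chains. With \<open>B i\<close> the slice of triples whose observed label is
  \<open>y i\<close>, all four claims are instances of the conditional inequality.\<close>

lemma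
  assumes y: "\<And>i. i \<in> Dcal \<Longrightarrow> y i \<in> {1..K}" and l: "l \<in> {1..K}" and e: "0 \<le> e"
  shows upper_dev_sets: "upper_dev y l e \<in> events"
    and lower_dev_sets: "lower_dev y l e \<in> events"
    and prob_upper_dev: "prob (upper_dev y l e) \<le> exp (- 2 * real (card {i\<in>Dcal. y i = l}) * e\<^sup>2) * prob (W y)"
    and prob_lower_dev: "prob (lower_dev y l e) \<le> exp (- 2 * real (card {i\<in>Dcal. y i = l}) * e\<^sup>2) * prob (W y)"
proof -
  define J where "J = {i\<in>Dcal. y i = l}"
  define B where "B = (\<lambda>i. {z \<in> space P. snd (snd z) = y i})"
  define B0 where "B0 = {z \<in> space P. snd (snd z) = l}"
  define R where "R = (\<lambda>q. {w \<in> space (MU \<Otimes>\<^sub>M P). score (fst w) (fst (snd w)) \<le> q})"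
  define R' where "R' = (\<lambda>q. {w \<in> space (MU \<Otimes>\<^sub>M P). \<not> score (fst w) (fst (snd w)) \<le> q})"
  have spU: "U \<omega> \<in> space MU" if "\<omega> \<in> space \<Omega>" for \<omega> using that measurable_space[OF U_measurable] by simp
  have B: "\<And>i. i \<in> Dcal \<Longrightarrow> B i \<in> sets P" "\<And>i. i \<in> Dcal \<Longrightarrow> measure P (B i) \<noteq> 0"
      "\<And>i. i \<in> J \<Longrightarrow> B i = B0" "B0 \<in> sets P"
    using label_prob_pos(1)[OF y] by (auto simp: B_def B0_def J_def less_le)
  have R: "R q \<in> sets (MU \<Otimes>\<^sub>M P)" "R' q \<in> sets (MU \<Otimes>\<^sub>M P)" for q
    unfolding R_def R'_def by measurable
  have PR: "Pair u -` R q = {z \<in> space P. score u (fst z) \<le> q}"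
      "Pair u -` R' q = {z \<in> space P. \<not> score u (fst z) \<le> q}" if "u \<in> space MU" for u q
    using that by (auto simp: R_def R'_def space_pair_measure)
  have chain: "Pair u -` R q \<subseteq> Pair u -` R q' \<or> Pair u -` R q' \<subseteq> Pair u -` R q"
      "Pair u -` R' q \<subseteq> Pair u -` R' q' \<or> Pair u -` R' q' \<subseteq> Pair u -` R' q" if "u \<in> space MU" for u q q'
    using linear[of q q'] by (auto simp: PR[OF that])
  have mu: "measure P (B0 \<inter> Pair u -` R q) / measure P B0 = Ft u l q"
      "measure P (B0 \<inter> Pair u -` R' q) / measure P B0 = 1 - Ft u l q" if "u \<in> space MU" for u q
  proof -
    have "B0 \<inter> Pair u -` R q = {z \<in> space P. snd (snd z) = l \<and> score u (fst z) \<le> q}"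
      "B0 \<inter> Pair u -` R' q = {z \<in> space P. snd (snd z) = l \<and> \<not> score u (fst z) \<le> q}"
      by (auto simp: PR[OF that] B0_def)
    thus "measure P (B0 \<inter> Pair u -` R q) / measure P B0 = Ft u l q"
      "measure P (B0 \<inter> Pair u -` R' q) / measure P B0 = 1 - Ft u l q"
      using Ft_compl[OF that l, of q] by (simp_all only: Ft_def B0_def)
  qed
  have WB: "W y = {\<omega>\<in>space \<Omega>. \<forall>i\<in>Dcal. Z \<omega> i \<in> B i}"
    by (auto simp: W_def B_def Z_def triple_def space_P)
  have cR: "{i\<in>J. (U \<omega>, Z \<omega> i) \<in> R q} = {i\<in>J. score (U \<omega>) (Xs i \<omega>) \<le> q}"
      "{i\<in>J. (U \<omega>, Z \<omega> i) \<in> R' q} = {i\<in>J. \<not> score (U \<omega>) (Xs i \<omega>) \<le> q}" if "\<omega> \<in> space \<Omega>" for \<omega> q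
    using spU[OF that] by (auto simp: R_def R'_def space_pair_measure Z_def J_def triple_def space_P)
  have up: "upper_dev y l e = {\<omega>\<in>space \<Omega>. (\<forall>i\<in>Dcal. Z \<omega> i \<in> B i) \<and> (\<exists>q\<in>\<rat>.
        real (card J) * (measure P (B0 \<inter> Pair (U \<omega>) -` R q) / measure P B0 + e)
        \<le> real (card {i\<in>J. (U \<omega>, Z \<omega> i) \<in> R q}))}"
    unfolding upper_dev_def WB J_def[symmetric] by (auto simp: mu spU cR)
  have lw: "lower_dev y l e = {\<omega>\<in>space \<Omega>. (\<forall>i\<in>Dcal. Z \<omega> i \<in> B i) \<and> (\<exists>q\<in>\<rat>.
        real (card J) * (measure P (B0 \<inter> Pair (U \<omega>) -` R' q) / measure P B0 + e)
        \<le> real (card {i\<in>J. (U \<omega>, Z \<omega> i) \<in> R' q}))}"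
    unfolding lower_dev_def WB J_def[symmetric] by (auto simp: mu spU cR)
  have J: "J \<subseteq> Dcal" by (auto simp: J_def)
  note dkw = finite_Dcal J prob_space_P U_measurable Z_measurable distr_U_Z distr_Z B countable_rat
  show "upper_dev y l e \<in> events" unfolding up
    by (rule dkw_conditional_sets[OF dkw R(1) chain(1) e])
  show "lower_dev y l e \<in> events" unfolding lw
    by (rule dkw_conditional_sets[OF dkw R(2) chain(2) e])
  show "prob (upper_dev y l e) \<le> exp (- 2 * real (card {i\<in>Dcal. y i = l}) * e\<^sup>2) * prob (W y)"
    unfolding up WB J_def[symmetric] by (rule dkw_conditional[OF dkw R(1) chain(1) e])
  show "prob (lower_dev y l e) \<le> exp (- 2 * real (card {i\<in>Dcal. y i = l}) * e\<^sup>2) * prob (W y)"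
    unfolding lw WB J_def[symmetric] by (rule dkw_conditional[OF dkw R(2) chain(2) e])
qed

lemma U_space: "\<omega> \<in> space \<Omega> \<Longrightarrow> U \<omega> \<in> space MU"
  using measurable_space[OF U_measurable] .

lemma Ft_tendsto_at_right:
  assumes u: "u \<in> space MU" and l: "l \<in> {1..K}"
  shows "(Ft u l \<longlongrightarrow> Ft u l a) (at_right a)"
proof -
  interpret P: prob_space P by (rule prob_space_P)
  define B0 where "B0 = {z \<in> space P. snd (snd z) = l}"
  have B0: "emeasure P B0 \<noteq> 0" using label_prob_pos(1)[OF l] by (auto simp: B0_def P.emeasure_eq_measure)
  have [measurable]: "(\<lambda>z. score u (fst z)) \<in> borel_measurable P" using u by measurable
  interpret B: prob_space "uniform_measure P B0" using B0 by (intro prob_space_uniform_measure) auto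
  have "measure (uniform_measure P B0) {z \<in> space P. score u (fst z) \<le> t} = Ft u l t" for t
  proof -
    have "B0 \<inter> {z \<in> space P. score u (fst z) \<le> t} = {z \<in> space P. snd (snd z) = l \<and> score u (fst z) \<le> t}"
      by (auto simp: B0_def)
    thus ?thesis using B0 by (subst measure_uniform_measure) (auto simp: Ft_def B0_def)
  qed
  moreover have "(\<lambda>z. score u (fst z)) \<in> borel_measurable (uniform_measure P B0)" by simp
  note tendsto_measure_le_at_right[OF B.finite_measure_axioms this, of a]
  ultimately show ?thesis by simp
qed

text \<open>Off the deviation event the inequality is strict at every rational threshold. Both sides
  are right-continuous, so it passes to all real thresholds in its weak form, which is
  enough.\<close>

lemma Fhat_le_Ft:
  assumes \<omega>: "\<omega> \<in> W y" "\<omega> \<notin> upper_dev y l e" and l: "l \<in> {1..K}"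
  shows "real (card {i\<in>{i\<in>Dcal. y i = l}. score (U \<omega>) (Xs i \<omega>) \<le> t}) \<le> real (card {i\<in>Dcal. y i = l}) * (Ft (U \<omega>) l t + e)"
proof (rule le_at_right_of_Rats[where a=t and f="\<lambda>t. real (card {i\<in>{i\<in>Dcal. y i = l}. score (U \<omega>) (Xs i \<omega>) \<le> t})"
    and g="\<lambda>t. real (card {i\<in>Dcal. y i = l}) * (Ft (U \<omega>) l t + e)"])
  have u: "U \<omega> \<in> space MU" using \<omega> by (auto simp: W_def U_space)
  show "((\<lambda>t. real (card {i\<in>{i\<in>Dcal. y i = l}. score (U \<omega>) (Xs i \<omega>) \<le> t})) \<longlongrightarrow>
      real (card {i\<in>{i\<in>Dcal. y i = l}. score (U \<omega>) (Xs i \<omega>) \<le> t})) (at_right t)"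
    using finite_Dcal by (intro tendsto_card_le_at_right) simp
  show "((\<lambda>t. real (card {i\<in>Dcal. y i = l}) * (Ft (U \<omega>) l t + e)) \<longlongrightarrow>
      real (card {i\<in>Dcal. y i = l}) * (Ft (U \<omega>) l t + e)) (at_right t)"
    by (intro tendsto_intros Ft_tendsto_at_right u l)
  show "real (card {i\<in>{i\<in>Dcal. y i = l}. score (U \<omega>) (Xs i \<omega>) \<le> q}) \<le> real (card {i\<in>Dcal. y i = l}) * (Ft (U \<omega>) l q + e)"
    if "q \<in> \<rat>" for q using \<omega> that by (auto simp: upper_dev_def)
qed

lemma Ft_le_Fhat:
  assumes \<omega>: "\<omega> \<in> W y" "\<omega> \<notin> lower_dev y l e" and l: "l \<in> {1..K}"
  shows "real (card {i\<in>Dcal. y i = l}) * (Ft (U \<omega>) l t - e) \<le> real (card {i\<in>{i\<in>Dcal. y i = l}. score (U \<omega>) (Xs i \<omega>) \<le> t})"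
proof (rule le_at_right_of_Rats[where a=t and g="\<lambda>t. real (card {i\<in>{i\<in>Dcal. y i = l}. score (U \<omega>) (Xs i \<omega>) \<le> t})"
    and f="\<lambda>t. real (card {i\<in>Dcal. y i = l}) * (Ft (U \<omega>) l t - e)"])
  have u: "U \<omega> \<in> space MU" using \<omega> by (auto simp: W_def U_space)
  show "((\<lambda>t. real (card {i\<in>{i\<in>Dcal. y i = l}. score (U \<omega>) (Xs i \<omega>) \<le> t})) \<longlongrightarrow>
      real (card {i\<in>{i\<in>Dcal. y i = l}. score (U \<omega>) (Xs i \<omega>) \<le> t})) (at_right t)"
    using finite_Dcal by (intro tendsto_card_le_at_right) simp
  show "((\<lambda>t. real (card {i\<in>Dcal. y i = l}) * (Ft (U \<omega>) l t - e)) \<longlongrightarrow>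
      real (card {i\<in>Dcal. y i = l}) * (Ft (U \<omega>) l t - e)) (at_right t)"
    by (intro tendsto_intros Ft_tendsto_at_right u l)
  fix q :: real assume q: "q \<in> \<rat>"
  define J where "J = {i\<in>Dcal. y i = l}"
  have J: "finite J" using finite_Dcal by (simp add: J_def)
  have "card J = card ({i\<in>J. score (U \<omega>) (Xs i \<omega>) \<le> q} \<union> {i\<in>J. \<not> score (U \<omega>) (Xs i \<omega>) \<le> q})"
    by (intro arg_cong[where f=card]) auto
  also have "\<dots> = card {i\<in>J. score (U \<omega>) (Xs i \<omega>) \<le> q} + card {i\<in>J. \<not> score (U \<omega>) (Xs i \<omega>) \<le> q}"
    using J by (intro card_Un_disjoint) auto
  finally have c: "real (card J) = real (card {i\<in>J. score (U \<omega>) (Xs i \<omega>) \<le> q}) + real (card {i\<in>J. \<not> score (U \<omega>) (Xs i \<omega>) \<le> q})"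
    by linarith
  have "real (card {i\<in>J. \<not> score (U \<omega>) (Xs i \<omega>) \<le> q}) < real (card J) * (1 - Ft (U \<omega>) l q + e)"
    using \<omega> q unfolding lower_dev_def J_def by (auto simp: not_le)
  hence "real (card J) * (Ft (U \<omega>) l q - e) \<le> real (card {i\<in>J. score (U \<omega>) (Xs i \<omega>) \<le> q})"
    using c by (simp add: algebra_simps)
  thus "real (card {i\<in>Dcal. y i = l}) * (Ft (U \<omega>) l q - e) \<le> real (card {i\<in>{i\<in>Dcal. y i = l}. score (U \<omega>) (Xs i \<omega>) \<le> q})"
    unfolding J_def .
qed

text \<open>For fixed \<open>\<omega>\<close> the set of feature vectors with score at most
  \<open>\<tau> \<omega>\<close> is a fixed Borel set, so the contamination identity applies to it
  even though the threshold is data-dependent.\<close>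

lemma cov_eq_weighted_Ft:
  assumes "\<omega> \<in> space \<Omega>"
  shows "cov \<omega> = (\<Sum>l\<in>{1..K}. V k l * Ft (U \<omega>) l (\<tau> \<omega>))" and "(\<Sum>l\<in>{1..K}. V k l) = 1"
proof -
  have "AE z in P. fst (snd z) \<in> {1..K}"
    unfolding P_def
  proof (subst AE_distr_iff)
    show "triple Xs Ys Yt 1 \<in> measurable \<Omega> triple_space" by (intro triple_measurable) simp
    show "{z \<in> space triple_space. fst (snd z) \<in> {1..K}} \<in> sets (triple_space :: ((real ^ 'd) \<times> nat \<times> nat) measure)"
    proof -
      have "(\<lambda>z. fst (snd z)) \<in> measurable (triple_space :: ((real ^ 'd) \<times> nat \<times> nat) measure) (count_space UNIV)"
        unfolding triple_space_def by measurable
      thus ?thesis by (rule measurable_sets_Collect) simp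
    qed
    show "AE \<omega> in \<Omega>. fst (snd (triple Xs Ys Yt 1 \<omega>)) \<in> {1..K}"
      using labels[of 1] by (auto simp: triple_def intro!: AE_I2)
  qed
  note lc = linear_contamination[OF prob_space_P sets_P this A1_ci[folded P_def] A1_pos[folded P_def] V_inv[folded P_def] k]
  have [measurable]: "score (U \<omega>) \<in> borel_measurable borel"
    using U_space[OF assms] by measurable
  have "{x. score (U \<omega>) x \<le> \<tau> \<omega>} \<in> sets borel" by measurable
  from lc[OF this] show "cov \<omega> = (\<Sum>l\<in>{1..K}. V k l * Ft (U \<omega>) l (\<tau> \<omega>))"
    by (simp add: cov_def Ft_def conj_commute)
  \<comment> \<open>The row sum is the same contamination identity for the whole feature space,
    where every conditional probability equals 1.\<close>
  have "(\<Sum>l\<in>{1..K}. V k l) = (\<Sum>l\<in>{1..K}. V k l *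
      (measure P {z \<in> space P. fst z \<in> UNIV \<and> snd (snd z) = l} / measure P {z \<in> space P. snd (snd z) = l}))"
    using label_prob_pos(1) by (intro sum.cong refl) (simp add: less_le)
  also have "\<dots> = measure P {z \<in> space P. fst z \<in> UNIV \<and> fst (snd z) = k} / measure P {z \<in> space P. fst (snd z) = k}"
    by (rule lc[symmetric]) simp
  also have "\<dots> = 1" using label_prob_pos(2)[OF k] by simp
  finally show "(\<Sum>l\<in>{1..K}. V k l) = 1" .
qed

section \<open>Splitting the error level and controlling the coverage on each label
  assignment\<close>

definition off_diag where "off_diag = (\<Sum>l\<in>{1..K} - {k}. \<bar>V k l\<bar>)"
definition \<gamma>1 where "\<gamma>1 = \<gamma> * (1 - rk K V k / 2)"
definition \<gamma>2 where "\<gamma>2 = \<gamma> * rk K V k / 2"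
definition e1 where "e1 m = sqrt (ln (1 / \<gamma>1) / (2 * real m))"
text \<open>The level \<open>\<gamma>2 / (2 * K)\<close> comes from a union bound over
  \<open>K\<close> classes and two tails; it absorbs the term \<open>ln (2 * K)\<close> of
  \<open>delta_cc\<close>.\<close>

definition e2 where "e2 m = sqrt (ln (1 / (\<gamma>2 / (2 * real K))) / (2 * real m))"

lemma off_diag_nonneg: "off_diag \<ge> 0" by (simp add: off_diag_def sum_nonneg)

lemma rk_bounds: "0 \<le> rk K V k" "rk K V k \<le> 1" "off_diag \<noteq> 0 \<Longrightarrow> 0 < rk K V k" "off_diag = 0 \<Longrightarrow> rk K V k = 0"
proof -
  define S where "S = (\<Sum>l\<in>{1..K}. \<bar>V k l\<bar>)"
  have r: "rk K V k = off_diag / S" by (simp add: rk_def off_diag_def S_def)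
  have S: "off_diag \<le> S" unfolding off_diag_def S_def by (intro sum_mono2) auto
  show "0 \<le> rk K V k" "rk K V k \<le> 1" "off_diag \<noteq> 0 \<Longrightarrow> 0 < rk K V k" "off_diag = 0 \<Longrightarrow> rk K V k = 0"
    using S off_diag_nonneg unfolding r by (auto simp: divide_le_eq_1)
qed

lemma \<gamma>1: "0 < \<gamma>1" "\<gamma>1 \<le> 1" and \<gamma>12: "\<gamma>1 + \<gamma>2 = \<gamma>" and \<gamma>2: "0 \<le> \<gamma>2" "\<gamma>2 \<le> 1" "off_diag \<noteq> 0 \<Longrightarrow> 0 < \<gamma>2"
proof -
  show "0 < \<gamma>1" using rk_bounds gamma by (simp add: \<gamma>1_def)
  show "0 \<le> \<gamma>2" using rk_bounds gamma by (simp add: \<gamma>2_def)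
  show "\<gamma>1 + \<gamma>2 = \<gamma>" by (simp add: \<gamma>1_def \<gamma>2_def algebra_simps)
  thus "\<gamma>1 \<le> 1" "\<gamma>2 \<le> 1" using gamma \<open>0 < \<gamma>1\<close> \<open>0 \<le> \<gamma>2\<close> by auto
  show "off_diag \<noteq> 0 \<Longrightarrow> 0 < \<gamma>2" using rk_bounds(3) gamma by (simp add: \<gamma>2_def)
qed

text \<open>In the degenerate row \<open>\<gamma>2\<close> is 0 and \<open>e2\<close> has no meaning
  as a radius, but its factor \<open>off_diag\<close> vanishes; this reproduces the case distinction
  inside \<open>delta_cc\<close>.\<close>

lemma delta_cc_eq: "delta_cc K V k m m' \<gamma> = e1 m + 2 * off_diag * e2 m'"
proof (cases "off_diag = 0")
  case True
  thus ?thesis unfolding delta_cc_def Let_def off_diag_def[symmetric] \<gamma>1_def[symmetric] by (simp add: e1_def)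
next
  case False
  have "ln (2 * real K) + ln (1 / \<gamma>2) = ln (1 / (\<gamma>2 / (2 * real K)))"
    using \<gamma>2(3)[OF False] k by (simp add: ln_div ln_mult)
  thus ?thesis using False
    unfolding delta_cc_def Let_def off_diag_def[symmetric] \<gamma>1_def[symmetric] \<gamma>2_def[symmetric]
    by (simp add: e1_def e2_def)
qed

text \<open>The deterministic core: outside the deviation events the surplus \<open>delta_cc\<close>
  demanded by the selection rule exactly pays for replacing the empirical combination by the true
  one.\<close>

lemma cov_ge:
  assumes \<omega>: "\<omega> \<in> W y" and ne: "\<And>l. l \<in> {1..K} \<Longrightarrow> {i\<in>Dcal. y i = l} \<noteq> {}"
  defines "c \<equiv> (\<lambda>l. card {i\<in>Dcal. y i = l})"
  assumes u: "\<omega> \<notin> upper_dev y k (e1 (c k))"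
    and d: "off_diag = 0 \<or> (\<forall>l\<in>{1..K}. \<omega> \<notin> upper_dev y l (e2 (Min (c ` {1..K}))) \<and> \<omega> \<notin> lower_dev y l (e2 (Min (c ` {1..K}))))"
  shows "1 - \<alpha> \<le> cov \<omega>"
proof -
  have sp: "\<omega> \<in> space \<Omega>" using \<omega> by (simp add: W_def)
  define D where "D = obsdata Xs Yt \<omega>"
  define s where "s = cscore K (Cfam (train (U \<omega>)))"
  have idx: "cal_idx Dcal D l = {i\<in>Dcal. y i = l}" for l
    using \<omega> by (auto simp: cal_idx_def D_def obsdata_def W_def)
  have nc: "ncount Dcal D = c" by (auto simp: ncount_def idx c_def)
  have nm: "nmin K Dcal D = Min (c ` {1..K})" by (simp add: nmin_def nc)
  have c0: "c l > 0" if "l \<in> {1..K}" for l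
    using ne[OF that] finite_Dcal by (simp add: c_def card_gt_0_iff)
  have Fh: "Fhat s Dcal D k l t = real (card {i\<in>{i\<in>Dcal. y i = l}. score (U \<omega>) (Xs i \<omega>) \<le> t}) / real (c l)" for l t
    unfolding Fhat_def idx nc by (simp add: s_def score_def D_def obsdata_def)
  have up: "Fhat s Dcal D k l t - Ft (U \<omega>) l t \<le> e" if "\<omega> \<notin> upper_dev y l e" "l \<in> {1..K}" for l t e
    using Fhat_le_Ft[OF \<omega> that, of t] c0[OF that(2)] unfolding Fh by (simp add: c_def field_simps)
  have low: "Ft (U \<omega>) l t - Fhat s Dcal D k l t \<le> e" if "\<omega> \<notin> lower_dev y l e" "l \<in> {1..K}" for l t e
    using Ft_le_Fhat[OF \<omega> that, of t] c0[OF that(2)] unfolding Fh by (simp add: c_def field_simps)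
  have \<tau>: "\<tau> \<omega> = tauhat_cc K V \<alpha> \<gamma> s Dcal D k" by (simp add: \<tau>_def s_def D_def)
  show ?thesis
  proof (cases "Ihat K V \<alpha> \<gamma> s Dcal D k = {}")
    \<comment> \<open>The fallback threshold is 1 and no score exceeds 1, so the coverage is
      complete.\<close>
    case True
    hence "\<tau> \<omega> = 1" by (simp add: \<tau> tauhat_cc_def)
    hence "cov \<omega> = 1" using score_unit_interval label_prob_pos(2)[OF k] by (simp add: cov_def)
    thus ?thesis using alpha by simp
  next
    case False
    \<comment> \<open>The bounds \<open>up\<close> and \<open>low\<close> hold for all thresholds
      simultaneously, so they may be evaluated at the data-dependent
      \<open>\<tau> \<omega>\<close>.\<close>
    have "(\<Sum>l\<in>{1..K}. V k l * Fhat s Dcal D k l (\<tau> \<omega>)) - (\<Sum>l\<in>{1..K}. V k l * Ft (U \<omega>) l (\<tau> \<omega>))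
        \<le> e1 (c k) + 2 * off_diag * e2 (Min (c ` {1..K}))"
      unfolding off_diag_def
    proof (rule weighted_deviation_bound[OF _ k cov_eq_weighted_Ft(2)[OF sp]])
      show "Fhat s Dcal D k k (\<tau> \<omega>) - Ft (U \<omega>) k (\<tau> \<omega>) \<le> e1 (c k)" by (rule up[OF u k])
      show "(\<Sum>l\<in>{1..K} - {k}. \<bar>V k l\<bar>) = 0 \<or>
          (\<forall>l\<in>{1..K}. \<bar>Fhat s Dcal D k l (\<tau> \<omega>) - Ft (U \<omega>) l (\<tau> \<omega>)\<bar> \<le> e2 (Min (c ` {1..K})))"
        using d up low unfolding off_diag_def[symmetric] by (auto simp: abs_le_iff)
    qed simp
    moreover have "1 - \<alpha> + delta_cc K V k (c k) (Min (c ` {1..K})) \<gamma> \<le> (\<Sum>l\<in>{1..K}. V k l * Fhat s Dcal D k l (\<tau> \<omega>))"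
      using tauhat_cc_weighted_Fhat[OF finite_Dcal k False] by (simp only: nc nm \<tau>)
    ultimately show ?thesis unfolding cov_eq_weighted_Ft(1)[OF sp] delta_cc_eq by simp
  qed
qed

text \<open>
  Needed because the measure of a non-measurable set would be \<open>0\<close>.
\<close>

lemma cov_ge_sets: "{\<omega> \<in> W y. 1 - \<alpha> \<le> cov \<omega>} \<in> events"
proof -
  interpret P: prob_space P by (rule prob_space_P)
  define t where "t = (\<lambda>\<omega>. tauhat_cc K V \<alpha> \<gamma> (cscore K (Cfam (train (U \<omega>)))) Dcal (\<lambda>i. (Xs i \<omega>, y i)) k)"
  have t[measurable]: "t \<in> borel_measurable \<Omega>"
    unfolding t_def
  proof (rule tauhat_cc_measurable[OF finite_Dcal])
    fix i assume "i \<in> Dcal"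
    hence [measurable]: "Xs i \<in> borel_measurable \<Omega>" using Dcal_sub by (intro Xs_measurable) blast
    show "(\<lambda>\<omega>. cscore K (Cfam (train (U \<omega>))) (fst (Xs i \<omega>, y i)) k) \<in> borel_measurable \<Omega>"
      unfolding fst_conv score_def[symmetric] by measurable
  qed simp
  have \<tau>t: "\<tau> \<omega> = t \<omega>" if "\<omega> \<in> W y" for \<omega>
    unfolding \<tau>_def t_def using that by (intro tauhat_cc_cong) (simp add: obsdata_def W_def)
  \<comment> \<open>The numerator of \<open>cov\<close> is the \<open>P\<close>-measure of a section
    of one jointly measurable set, taken at the point \<open>(U \<omega>, t \<omega>)\<close>;
    measurability then follows from that of section measures.\<close>
  define R where "R = {w \<in> space ((MU \<Otimes>\<^sub>M borel) \<Otimes>\<^sub>M P). fst (snd (snd w)) = k \<and> score (fst (fst w)) (fst (snd w)) \<le> snd (fst w)}"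
  have "R \<in> sets ((MU \<Otimes>\<^sub>M borel) \<Otimes>\<^sub>M P)" unfolding R_def by measurable
  hence "(\<lambda>v. measure P (Pair v -` R)) \<in> borel_measurable (MU \<Otimes>\<^sub>M borel)"
    unfolding measure_def by (intro borel_measurable_enn2real P.measurable_emeasure_Pair)
  moreover have "(\<lambda>\<omega>. (U \<omega>, t \<omega>)) \<in> measurable \<Omega> (MU \<Otimes>\<^sub>M borel)" by measurable
  ultimately have m: "(\<lambda>\<omega>. measure P (Pair (U \<omega>, t \<omega>) -` R)) \<in> borel_measurable \<Omega>"
    by (rule measurable_compose[rotated])
  have "cov \<omega> = measure P (Pair (U \<omega>, t \<omega>) -` R) / measure P {z \<in> space P. fst (snd z) = k}" if "\<omega> \<in> W y" for \<omega>
    unfolding cov_def \<tau>t[OF that] using that U_space[of \<omega>]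
    by (intro arg_cong2[where f="(/)"] arg_cong[where f="measure P"]) (auto simp: R_def space_pair_measure W_def)
  hence "{\<omega> \<in> W y. 1 - \<alpha> \<le> cov \<omega>} = W y \<inter> {\<omega> \<in> space \<Omega>. 1 - \<alpha> \<le> measure P (Pair (U \<omega>, t \<omega>) -` R) / measure P {z \<in> space P. fst (snd z) = k}}"
    by (auto simp: W_def)
  also have "\<dots> \<in> events"
    by (intro sets.Int W_sets borel_measurable_le borel_measurable_divide borel_measurable_const m)
  finally show ?thesis .
qed

text \<open>Union bound over one upper deviation of class \<open>k\<close> at level
  \<open>\<gamma>1\<close> and, unless the off-diagonal weights vanish, \<open>2 * K\<close>
  deviations at level \<open>\<gamma>2 / (2 * K)\<close>. The levels add up to
  \<open>\<gamma>1 + \<gamma>2 = \<gamma>\<close>; in the degenerate row \<open>\<gamma>1\<close> is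
  already \<open>\<gamma>\<close>.\<close>

lemma prob_cov_less:
  assumes y: "\<And>i. i \<in> Dcal \<Longrightarrow> y i \<in> {1..K}" and ne: "\<And>l. l \<in> {1..K} \<Longrightarrow> {i\<in>Dcal. y i = l} \<noteq> {}"
  shows "prob {\<omega> \<in> W y. \<not> 1 - \<alpha> \<le> cov \<omega>} \<le> \<gamma> * prob (W y)"
proof -
  define c where "c = (\<lambda>l. card {i\<in>Dcal. y i = l})"
  define m where "m = Min (c ` {1..K})"
  have K: "{1..K} \<noteq> {}" using k by auto
  have c0: "c l > 0" if "l \<in> {1..K}" for l
    using ne[OF that] finite_Dcal by (simp add: c_def card_gt_0_iff)
  have m0: "0 < m" unfolding m_def using K c0 by (subst Min_gr_iff) auto
  have mc: "m \<le> c l" if "l \<in> {1..K}" for l unfolding m_def using that by (intro Min_le) auto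
  have e1: "0 \<le> e1 x" for x unfolding e1_def using \<gamma>1 by (intro real_sqrt_ge_zero divide_nonneg_nonneg) auto
  define E where "E = upper_dev y k (e1 (c k))"
  define E' where "E' = (\<lambda>l. upper_dev y l (e2 m) \<union> lower_dev y l (e2 m))"
  have E: "E \<in> events" unfolding E_def by (rule upper_dev_sets[OF y k e1])
  have "prob E \<le> exp (- 2 * real (c k) * (e1 (c k))\<^sup>2) * prob (W y)"
    unfolding E_def c_def using prob_upper_dev[OF y k e1] by simp
  also have "\<dots> \<le> \<gamma>1 * prob (W y)"
    unfolding e1_def using \<gamma>1 c0[OF k] by (intro mult_right_mono exp_neg_sqrt_log) auto
  finally have pE: "prob E \<le> \<gamma>1 * prob (W y)" .
  show ?thesis
  proof (cases "off_diag = 0")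
    case True
    have "{\<omega> \<in> W y. \<not> 1 - \<alpha> \<le> cov \<omega>} \<subseteq> E"
      using cov_ge[OF _ ne] True unfolding E_def c_def by auto
    hence "prob {\<omega> \<in> W y. \<not> 1 - \<alpha> \<le> cov \<omega>} \<le> prob E" using E by (rule finite_measure_mono)
    also note pE
    also have "\<gamma>1 = \<gamma>" using rk_bounds(4)[OF True] by (simp add: \<gamma>1_def)
    finally show ?thesis .
  next
    case False
    define g where "g = \<gamma>2 / (2 * real K)"
    have g: "0 < g" "g \<le> 1" using \<gamma>2(2) \<gamma>2(3)[OF False] k by (auto simp: g_def divide_le_eq)
    have e2: "0 \<le> e2 m" unfolding e2_def g_def[symmetric] using g
      by (intro real_sqrt_ge_zero divide_nonneg_nonneg) auto
    have E': "E' l \<in> events" and pE': "prob (E' l) \<le> 2 * g * prob (W y)" if l: "l \<in> {1..K}" for l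
    proof -
      have ev: "upper_dev y l (e2 m) \<in> events" "lower_dev y l (e2 m) \<in> events"
        by (rule upper_dev_sets[OF y l e2] lower_dev_sets[OF y l e2]; assumption)+
      thus "E' l \<in> events" by (simp add: E'_def)
      have b: "exp (- 2 * real (c l) * (e2 m)\<^sup>2) * prob (W y) \<le> g * prob (W y)"
        unfolding e2_def g_def[symmetric] using g m0 mc[OF l] by (intro mult_right_mono exp_neg_sqrt_log) auto
      have "prob (E' l) \<le> prob (upper_dev y l (e2 m)) + prob (lower_dev y l (e2 m))"
        unfolding E'_def using ev by (rule measure_Un_le)
      also have "prob (upper_dev y l (e2 m)) \<le> g * prob (W y)"
        using prob_upper_dev[OF y l e2] b unfolding c_def by (rule order_trans)
      also have "prob (lower_dev y l (e2 m)) \<le> g * prob (W y)"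
        using prob_lower_dev[OF y l e2] b unfolding c_def by (rule order_trans)
      finally show "prob (E' l) \<le> 2 * g * prob (W y)" by simp
    qed
    have "{\<omega> \<in> W y. \<not> 1 - \<alpha> \<le> cov \<omega>} \<subseteq> E \<union> (\<Union>l\<in>{1..K}. E' l)"
    proof
      fix \<omega> assume \<omega>: "\<omega> \<in> {\<omega> \<in> W y. \<not> 1 - \<alpha> \<le> cov \<omega>}"
      show "\<omega> \<in> E \<union> (\<Union>l\<in>{1..K}. E' l)"
      proof (rule ccontr)
        assume "\<omega> \<notin> E \<union> (\<Union>l\<in>{1..K}. E' l)"
        hence "1 - \<alpha> \<le> cov \<omega>"
          using \<omega> ne by (intro cov_ge[where y=y]) (auto simp: E_def E'_def c_def m_def)
        thus False using \<omega> by simp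
      qed
    qed
    hence "prob {\<omega> \<in> W y. \<not> 1 - \<alpha> \<le> cov \<omega>} \<le> prob (E \<union> (\<Union>l\<in>{1..K}. E' l))"
      using E E' by (intro finite_measure_mono) auto
    also have "\<dots> \<le> prob E + prob (\<Union>l\<in>{1..K}. E' l)"
      using E E' by (intro measure_Un_le) auto
    also have "prob (\<Union>l\<in>{1..K}. E' l) \<le> (\<Sum>l\<in>{1..K}. prob (E' l))"
      using E' by (intro finite_measure_subadditive_finite) auto
    also have "\<dots> \<le> (\<Sum>l\<in>{1..K}. 2 * g * prob (W y))" by (intro sum_mono pE')
    also have "\<dots> = \<gamma>2 * prob (W y)" using k by (simp add: g_def)
    also note pE
    also have "\<gamma>1 * prob (W y) + \<gamma>2 * prob (W y) = \<gamma> * prob (W y)" by (simp add: \<gamma>12 flip: distrib_right)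
    finally show ?thesis by simp
  qed
qed

section \<open>From the coverage functional to the output of the algorithm\<close>

lemma mem_Chat_cc_iff:
  "k \<in> Chat_cc K V \<alpha> \<gamma> Cfam Dtr Dcal Xs Yt \<omega> x \<longleftrightarrow> score (U \<omega>) x \<le> \<tau> \<omega>"
proof -
  define C where "C = Cfam (train (U \<omega>))"
  define v where "v = tauhat_cc K V \<alpha> \<gamma> (cscore K C) Dcal (obsdata Xs Yt \<omega>)"
  \<comment> \<open>The score convention speaks only of valid threshold vectors, so every coordinate
    has to be checked, not just coordinate \<open>k\<close>.\<close>
  have "v j \<in> {0..1}" if "j \<in> {1..K}" for j
    unfolding v_def using cscore_unit_interval[OF Cpred(1) that] finite_Dcal
    by (intro tauhat_cc_unit_interval) (auto simp: C_def)
  hence "thr_vec K v" by (simp add: thr_vec_def)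
  hence "k \<in> C x v \<longleftrightarrow> cscore K C x k \<le> v k"
    using Cpred(2) k unfolding score_convention_def C_def by blast
  thus ?thesis by (simp add: Chat_cc_def Let_def v_def C_def score_def \<tau>_def train_U)
qed

text \<open>The data are frozen at \<open>\<omega>\<close> while the test point varies with a
  separate sample point \<open>\<omega>'\<close>. Hence only the marginal law of the test triple
  matters, and this is \<open>P\<close> by identical distribution.\<close>

lemma conditional_coverage_eq_cov:
  assumes \<omega>: "\<omega> \<in> space \<Omega>"
  shows "prob {\<omega>' \<in> space \<Omega>. Ys (n+1) \<omega>' = k \<and>
            Ys (n+1) \<omega>' \<in> Chat_cc K V \<alpha> \<gamma> Cfam Dtr Dcal Xs Yt \<omega> (Xs (n+1) \<omega>')}
         / prob {\<omega>' \<in> space \<Omega>. Ys (n+1) \<omega>' = k} = cov \<omega>"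
proof -
  let ?T = "triple Xs Ys Yt (n+1)"
  have T: "?T \<in> measurable \<Omega> P"
    using triple_measurable[of "n+1"] by (simp add: measurable_cong_sets[OF refl sets_P])
  have PT: "P = distr \<Omega> P ?T"
    using distr_triple[of "n+1"] by (simp add: distr_cong[OF refl sets_P])
  have meas: "measure P {z \<in> space P. Q z} = prob {\<omega>' \<in> space \<Omega>. Q (?T \<omega>')}" if "{z \<in> space P. Q z} \<in> sets P" for Q
  proof -
    have "measure P {z \<in> space P. Q z} = prob (?T -` {z \<in> space P. Q z} \<inter> space \<Omega>)"
      by (subst PT) (rule measure_distr[OF T that])
    also have "?T -` {z \<in> space P. Q z} \<inter> space \<Omega> = {\<omega>' \<in> space \<Omega>. Q (?T \<omega>')}"
      by (auto simp: space_P)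
    finally show ?thesis .
  qed
  have [measurable]: "(\<lambda>z. score (U \<omega>) (fst z)) \<in> borel_measurable P" using U_space[OF \<omega>] by measurable
  have "{\<omega>' \<in> space \<Omega>. Ys (n+1) \<omega>' = k \<and> Ys (n+1) \<omega>' \<in> Chat_cc K V \<alpha> \<gamma> Cfam Dtr Dcal Xs Yt \<omega> (Xs (n+1) \<omega>')}
      = {\<omega>' \<in> space \<Omega>. Ys (n+1) \<omega>' = k \<and> score (U \<omega>) (Xs (n+1) \<omega>') \<le> \<tau> \<omega>}"
    using mem_Chat_cc_iff by auto
  thus ?thesis
    using meas[of "\<lambda>z. fst (snd z) = k \<and> score (U \<omega>) (fst z) \<le> \<tau> \<omega>"] meas[of "\<lambda>z. fst (snd z) = k"]
    by (simp add: cov_def triple_def)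
qed

text \<open>The bound holds on every label assignment compatible with the counts, so it holds for
  their disjoint union. Positive counts ensure that each class is nonempty under each such
  assignment.\<close>

lemma cond_prob_cov_ge:
  assumes pos: "\<And>j. j \<in> {1..K} \<Longrightarrow> nk j \<ge> 1"
    and cnt: "prob {\<omega> \<in> space \<Omega>. \<forall>j\<in>{1..K}. ncount Dcal (obsdata Xs Yt \<omega>) j = nk j} > 0"
  shows "1 - \<gamma> \<le> cond_prob \<Omega> (\<lambda>\<omega>. 1 - \<alpha> \<le> cov \<omega>) (\<lambda>\<omega>. \<forall>j\<in>{1..K}. ncount Dcal (obsdata Xs Yt \<omega>) j = nk j)"
proof -
  define C where "C = {\<omega> \<in> space \<Omega>. \<forall>j\<in>{1..K}. ncount Dcal (obsdata Xs Yt \<omega>) j = nk j}"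
  define Y where "Y = {y \<in> Dcal \<rightarrow>\<^sub>E {1..K}. \<forall>j\<in>{1..K}. card {i\<in>Dcal. y i = j} = nk j}"
  have finY: "finite Y" unfolding Y_def using finite_Dcal by (simp add: finite_PiE)
  have ncW: "ncount Dcal (obsdata Xs Yt \<omega>) j = card {i\<in>Dcal. y i = j}" if "\<omega> \<in> W y" for \<omega> y j
  proof -
    have "cal_idx Dcal (obsdata Xs Yt \<omega>) j = {i\<in>Dcal. y i = j}"
      using that by (auto simp: cal_idx_def obsdata_def W_def)
    thus ?thesis by (simp add: ncount_def)
  qed
  have CW: "C = (\<Union>y\<in>Y. W y)"
  proof
    show "C \<subseteq> (\<Union>y\<in>Y. W y)"
    proof
      fix \<omega> assume \<omega>: "\<omega> \<in> C"
      define y where "y = (\<lambda>i\<in>Dcal. Yt i \<omega>)"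
      have W: "\<omega> \<in> W y" using \<omega> by (simp add: W_def y_def C_def)
      have "y \<in> Dcal \<rightarrow>\<^sub>E {1..K}" using \<omega> labels Dcal_sub unfolding y_def C_def by (intro restrict_PiE_iff[THEN iffD2]) blast
      hence "y \<in> Y" using \<omega> ncW[OF W] by (simp add: Y_def C_def)
      thus "\<omega> \<in> (\<Union>y\<in>Y. W y)" using W by blast
    qed
    show "(\<Union>y\<in>Y. W y) \<subseteq> C"
    proof
      fix \<omega> assume "\<omega> \<in> (\<Union>y\<in>Y. W y)"
      then obtain y where y: "y \<in> Y" "\<omega> \<in> W y" by blast
      moreover have "\<omega> \<in> space \<Omega>" using y(2) by (simp add: W_def)
      ultimately show "\<omega> \<in> C" by (simp add: C_def Y_def ncW[OF y(2)])
    qed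
  qed
  have disj: "disjoint_family_on W Y"
    unfolding disjoint_family_on_def
  proof (intro ballI impI)
    fix y y' assume y: "y \<in> Y" "y' \<in> Y" "y \<noteq> y'"
    \<comment> \<open>Assignments in \<open>Y\<close> are extensional, so two different ones must
      already differ at an index in \<open>Dcal\<close>.\<close>
    then obtain i where "i \<in> Dcal" "y i \<noteq> y' i" unfolding Y_def by (metis (no_types, lifting) PiE_ext mem_Collect_eq)
    thus "W y \<inter> W y' = {}" by (auto simp: W_def)
  qed
  have C: "prob C = (\<Sum>y\<in>Y. prob (W y))"
    unfolding CW using finY disj W_sets by (intro finite_measure_finite_Union) auto
  have "(1 - \<gamma>) * prob C = (\<Sum>y\<in>Y. prob (W y) - \<gamma> * prob (W y))"
    unfolding C by (simp add: sum_distrib_left left_diff_distrib)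
  also have "\<dots> \<le> (\<Sum>y\<in>Y. prob {\<omega> \<in> W y. 1 - \<alpha> \<le> cov \<omega>})"
  proof (rule sum_mono)
    fix y assume y: "y \<in> Y"
    have yK: "y i \<in> {1..K}" if "i \<in> Dcal" for i using y that by (auto simp: Y_def)
    have ne: "{i\<in>Dcal. y i = l} \<noteq> {}" if "l \<in> {1..K}" for l
    proof
      assume "{i\<in>Dcal. y i = l} = {}"
      hence "card {i\<in>Dcal. y i = l} = 0" by (simp only: card.empty)
      moreover have "card {i\<in>Dcal. y i = l} = nk l" using y that by (simp add: Y_def)
      ultimately show False using pos[OF that] by simp
    qed
    have "{\<omega> \<in> W y. \<not> 1 - \<alpha> \<le> cov \<omega>} = W y - {\<omega> \<in> W y. 1 - \<alpha> \<le> cov \<omega>}" by auto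
    hence "prob {\<omega> \<in> W y. \<not> 1 - \<alpha> \<le> cov \<omega>} = prob (W y) - prob {\<omega> \<in> W y. 1 - \<alpha> \<le> cov \<omega>}"
      using finite_measure_Diff[OF W_sets[of y] cov_ge_sets[of y]] by auto
    thus "prob (W y) - \<gamma> * prob (W y) \<le> prob {\<omega> \<in> W y. 1 - \<alpha> \<le> cov \<omega>}"
      using prob_cov_less[OF yK ne] by linarith
  qed
  also have "\<dots> = prob (\<Union>y\<in>Y. {\<omega> \<in> W y. 1 - \<alpha> \<le> cov \<omega>})"
    using finY disj cov_ge_sets by (intro finite_measure_finite_Union[symmetric]) (auto simp: disjoint_family_on_def)
  also have "(\<Union>y\<in>Y. {\<omega> \<in> W y. 1 - \<alpha> \<le> cov \<omega>}) = {\<omega> \<in> C. 1 - \<alpha> \<le> cov \<omega>}" unfolding CW by blast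
  also have "\<dots> = {\<omega> \<in> space \<Omega>. 1 - \<alpha> \<le> cov \<omega> \<and> (\<forall>j\<in>{1..K}. ncount Dcal (obsdata Xs Yt \<omega>) j = nk j)}"
    unfolding C_def by blast
  finally show ?thesis
    using cnt unfolding cond_prob_def C_def by (simp only: pos_le_divide_eq)
qed

end

theorem mainTheorem16:
  fixes \<Omega> :: "'w measure"
    and Xs :: "nat \<Rightarrow> 'w \<Rightarrow> real ^ 'd"
    and Ys Yt :: "nat \<Rightarrow> 'w \<Rightarrow> nat"
    and K n :: nat
    and Dtr Dcal :: "nat set"
    and Cfam :: "(nat \<Rightarrow> (real ^ 'd) \<times> nat) \<Rightarrow> real ^ 'd \<Rightarrow> (nat \<Rightarrow> real) \<Rightarrow> nat set"
    and V :: "nat \<Rightarrow> nat \<Rightarrow> real"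
    and \<alpha> \<gamma> :: real
    and nk :: "nat \<Rightarrow> nat"
    and k :: nat
  assumes K2: "K \<ge> 2" and n2: "n \<ge> 2"
    and prob: "prob_space \<Omega>"
    and iid_indep: "prob_space.indep_vars \<Omega> (\<lambda>_. triple_space) (triple Xs Ys Yt) {1..n+1}"
    and iid_dist: "\<forall>i\<in>{1..n+1}. distr \<Omega> triple_space (triple Xs Ys Yt i)
                                  = distr \<Omega> triple_space (triple Xs Ys Yt 1)"
    and labels: "\<forall>i\<in>{1..n+1}. \<forall>\<omega>\<in>space \<Omega>. Ys i \<omega> \<in> {1..K} \<and> Yt i \<omega> \<in> {1..K}"
    and A1_ci: "cond_indep_X_Yt_given_Y K borel (distr \<Omega> triple_space (triple Xs Ys Yt 1))"
    and A1_pos: "lab_pos K (distr \<Omega> triple_space (triple Xs Ys Yt 1))"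
    and V_inv: "is_inverse_mat K (Mmat (distr \<Omega> triple_space (triple Xs Ys Yt 1))) V"
    and split: "Dtr \<inter> Dcal = {}" "Dtr \<union> Dcal = {1..n}" "Dtr \<noteq> {}" "Dcal \<noteq> {}"
    and Cpred: "\<forall>t. is_prediction_function K (Cfam t) \<and> score_convention K (Cfam t)"
    and Cmeas: "\<forall>j\<in>{1..K}. (\<lambda>(t, x). cscore K (Cfam t) x j)
                  \<in> borel_measurable (train_space Dtr \<Otimes>\<^sub>M borel)"
    and alpha: "0 < \<alpha>" "\<alpha> < 1"
    and gamma: "0 < \<gamma>" "\<gamma> < 1"
    and counts_pos: "\<forall>j\<in>{1..K}. nk j \<ge> 1"
    and counts_cond: "measure \<Omega> {\<omega> \<in> space \<Omega>. \<forall>j\<in>{1..K}. ncount Dcal (obsdata Xs Yt \<omega>) j = nk j} > 0"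
    and k: "k \<in> {1..K}"
  shows "cond_prob \<Omega>
           (\<lambda>\<omega>. measure \<Omega> {\<omega>' \<in> space \<Omega>. Ys (n+1) \<omega>' = k \<and>
                     Ys (n+1) \<omega>' \<in> Chat_cc K V \<alpha> \<gamma> Cfam Dtr Dcal Xs Yt \<omega> (Xs (n+1) \<omega>')}
                  / measure \<Omega> {\<omega>' \<in> space \<Omega>. Ys (n+1) \<omega>' = k}
                 \<ge> 1 - \<alpha>)
           (\<lambda>\<omega>. \<forall>j\<in>{1..K}. ncount Dcal (obsdata Xs Yt \<omega>) j = nk j)
         \<ge> 1 - \<gamma>"
proof -
  interpret prob_space \<Omega> by (rule prob)
  interpret contaminated_sample \<Omega> Xs Ys Yt K n Dtr Dcal Cfam V \<alpha> \<gamma> k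
    using iid_indep iid_dist labels A1_ci A1_pos V_inv split Cpred Cmeas alpha gamma k
    by unfold_locales blast+
  define good where "good = (\<lambda>\<omega>. measure \<Omega> {\<omega>' \<in> space \<Omega>. Ys (n+1) \<omega>' = k \<and>
       Ys (n+1) \<omega>' \<in> Chat_cc K V \<alpha> \<gamma> Cfam Dtr Dcal Xs Yt \<omega> (Xs (n+1) \<omega>')}
     / measure \<Omega> {\<omega>' \<in> space \<Omega>. Ys (n+1) \<omega>' = k} \<ge> 1 - \<alpha>)"
  let ?c = "\<lambda>\<omega>. \<forall>j\<in>{1..K}. ncount Dcal (obsdata Xs Yt \<omega>) j = nk j"
  have "{\<omega> \<in> space \<Omega>. good \<omega> \<and> ?c \<omega>} = {\<omega> \<in> space \<Omega>. 1 - \<alpha> \<le> cov \<omega> \<and> ?c \<omega>}"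
    unfolding good_def using conditional_coverage_eq_cov by auto
  hence "cond_prob \<Omega> good ?c = cond_prob \<Omega> (\<lambda>\<omega>. 1 - \<alpha> \<le> cov \<omega>) ?c" by (simp only: cond_prob_def)
  also have "\<dots> \<ge> 1 - \<gamma>" using counts_pos counts_cond by (intro cond_prob_cov_ge) auto
  finally show ?thesis unfolding good_def .
qed

end
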